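(* Let $K$ be a field of characteristic $0$ and let $\delta$ be a Weitzenböck derivation such that $X_d$ is a Jordan basis of $\delta$ acting on $KX_d$ and $\delta$ has a $1\times 1$ Jordan cell corresponding to $x_d$ (so $\delta$ acts as a nilpotent linear operator on $KX_{d-1}$ and $\delta(x_d)=0$). Let $\{v_i\mid i\in I\}$ and $\{u_j\mid j\in J\}$ be, respectively, bases of the vector spaces $(L_{d-1}'/L_{d-1}'')^{\delta}$ and $\omega(K[X_{d-1}])^{\delta}$ consisting of elements homogeneous with respect to both the $\mathbb{Z}$-grading (total degree) and the $\mathbb{Z}^2$-grading (bidegree). Then the vector space $(L_d'/L_d'')^{\delta}$ has a basis $$\{v_ix_d^n,\ \pi(u_j)x_d^n\mid i\in I,\ j\in J,\ n\geq 0\}.$$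
   Context: $X_m=\{x_1,\ldots,x_m\}$; $KX_m$ is the $K$-vector space with basis $X_m$; $K[X_m]$ is the polynomial algebra. $L_m$ is the free Lie algebra over $K$ freely generated by $X_m$, $L_m'=[L_m,L_m]$, $L_m''=[L_m',L_m']$, and $L_m/L_m''$ is the free metabelian Lie algebra, whose free generators are again denoted $x_1,\ldots,x_m$. $L_{d-1}/L_{d-1}''$ is regarded as the subalgebra of $L_d/L_d''$ generated by $x_1,\ldots,x_{d-1}$. A nonzero nilpotent linear operator $\delta$ of $KX_d$ extends uniquely to a derivation of $K[X_d]$ and of $L_d/L_d''$; these are called Weitzenböck derivations and denoted by the same symbol $\delta$. Since $\delta$ preserves $KX_{d-1}$, it also acts on $K[X_{d-1}]$ and $L_{d-1}/L_{d-1}''$. For any $\delta$-stable space $V$, $V^{\delta}=\{v\in V\mid\delta(v)=0\}$. Module structure: $L_m'/L_m''$ is a (right) $K[X_m]$-module via $u\,f(x_1,\ldots,x_m)=u\,f(\mathrm{ad}\,x_1,\ldots,\mathrm{ad}\,x_m)$ with $u\,\mathrm{ad}\,x_j=[u,x_j]$. Lie commutators are left normed. Gradings: the $\mathbb{Z}$-grading is by total degree in the variables $X_d$. The $\mathbb{Z}^2$-grading: if $\{x_j,x_{j+1},\ldots,x_{j+p}\}$ is the part of the Jordan basis $X_d$ corresponding to one Jordan cell of size $(p+1)\times(p+1)$, with $\delta(x_j)=0$ and $\delta(x_{j+k})$ a nonzero scalar multiple of $x_{j+k-1}$ for $k=1,\ldots,p$, then $x_{j+k}$ has bidegree $(p-k,k)$,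 $k=0,\ldots,p$; bidegrees are extended additively to products. (In particular $x_d$ has bidegree $(0,0)$.) $\omega(K[X_{d-1}])$ is the augmentation ideal of $K[X_{d-1}]$, i.e. the ideal of all polynomials without constant term. The $K$-linear map $\pi:\omega(K[X_{d-1}])\to L_d'/L_d''$ is defined on monomials by $$\pi(x_{j_1}\cdots x_{j_n})=\sum_{k=1}^n[x_d,x_{j_k}]\,x_{j_1}\cdots x_{j_{k-1}}x_{j_{k+1}}\cdots x_{j_n},\quad n\geq 1,$$ where the polynomial factor acts through the module structure. *)

theory Defs
  imports Complex_Main "HOL-Library.Poly_Mapping" "HOL-Library.Product_Plus"
begin

definition pm_scale :: "'k::field \<Rightarrow> ('a \<Rightarrow>\<^sub>0 'k) \<Rightarrow> ('a \<Rightarrow>\<^sub>0 'k)"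
  where "pm_scale c p = Poly_Mapping.map ((*) c) p"

lemma lookup_pm_scale [simp]:
  "Poly_Mapping.lookup (pm_scale c p) x = c * Poly_Mapping.lookup p x"
  unfolding pm_scale_def by (transfer) (auto simp: when_def)

interpretation pm: vector_space "pm_scale :: 'k::field \<Rightarrow> ('a \<Rightarrow>\<^sub>0 'k) \<Rightarrow> ('a \<Rightarrow>\<^sub>0 'k)"
  by unfold_locales (auto intro!: poly_mapping_eqI simp: lookup_add algebra_simps)

text \<open>Notions for an arbitrary algebra with scalar multiplication \<open>scale\<close> and product \<open>mult\<close>.\<close>

definition commutator_space ::
  "('k::field \<Rightarrow> 'a::ab_group_add \<Rightarrow> 'a) \<Rightarrow> ('a \<Rightarrow> 'a \<Rightarrow> 'a) \<Rightarrow> 'a set \<Rightarrow> 'a set"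
  where "commutator_space scale mult S = module.span scale {mult a b | a b. a \<in> S \<and> b \<in> S}"

definition generated_subalgebra ::
  "('k::field \<Rightarrow> 'a::ab_group_add \<Rightarrow> 'a) \<Rightarrow> ('a \<Rightarrow> 'a \<Rightarrow> 'a) \<Rightarrow> 'a set \<Rightarrow> 'a set"
  where "generated_subalgebra scale mult X =
    (\<lambda>S. module.subspace scale S \<and> (\<forall>a\<in>S. \<forall>b\<in>S. mult a b \<in> S)) hull X"

definition derivation ::
  "('k::field \<Rightarrow> 'a::ab_group_add \<Rightarrow> 'a) \<Rightarrow> ('a \<Rightarrow> 'a \<Rightarrow> 'a) \<Rightarrow> ('a \<Rightarrow> 'a) \<Rightarrow> bool"
  where "derivation scale mult D \<longleftrightarrow>
    Vector_Spaces.linear scale scale D \<and> (\<forall>a b. D (mult a b) = mult (D a) b + mult a (D b))"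

definition basis_family ::
  "('k::field \<Rightarrow> 'a::ab_group_add \<Rightarrow> 'a) \<Rightarrow> 'i set \<Rightarrow> ('i \<Rightarrow> 'a) \<Rightarrow> 'a set \<Rightarrow> bool"
  where "basis_family scale I v V \<longleftrightarrow>
    inj_on v I \<and> \<not> module.dependent scale (v ` I) \<and> module.span scale (v ` I) = V"

definition kernel_in :: "('a \<Rightarrow> 'a::zero) \<Rightarrow> 'a set \<Rightarrow> 'a set"
  where "kernel_in D V = {v \<in> V. D v = 0}"


section \<open>The free Lie algebra\<close>

text \<open>
  The free Lie algebra is the free nonassociative algebra, i.e. the vector space spanned by all
  bracketed words, modulo the two-sided ideal generated by all squares and all Jacobi sums.
\<close>

datatype 'x word = Gen 'x | Br "'x word" "'x word"

lift_definition na_mult :: "('x word \<Rightarrow>\<^sub>0 'k::field) \<Rightarrow> ('x word \<Rightarrow>\<^sub>0 'k) \<Rightarrow> ('x word \<Rightarrow>\<^sub>0 'k)"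
  is "\<lambda>p q w. case w of Gen _ \<Rightarrow> 0 | Br a b \<Rightarrow> p a * q b"
proof -
  fix p q :: "'x word \<Rightarrow> 'k"
  assume "finite {w. p w \<noteq> 0}" "finite {w. q w \<noteq> 0}"
  then have "finite ((\<lambda>(a, b). Br a b) ` ({w. p w \<noteq> 0} \<times> {w. q w \<noteq> 0}))"
    by blast
  then show "finite {w. (case w of Gen _ \<Rightarrow> 0 | Br a b \<Rightarrow> p a * q b) \<noteq> 0}"
    proof (rule rev_finite_subset, intro subsetI)
    fix w
    assume "w \<in> {w. (case w of Gen _ \<Rightarrow> 0 | Br a b \<Rightarrow> p a * q b) \<noteq> 0}"
    then show "w \<in> (\<lambda>(a, b). Br a b) ` ({w. p w \<noteq> 0} \<times> {w. q w \<noteq> 0})"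
      by (cases w) auto
  qed
qed

lemma na_mult_bilinear:
  "na_mult (p + p') q = na_mult p q + na_mult p' q"
  "na_mult p (q + q') = na_mult p q + na_mult p q'"
  "na_mult (p - p') q = na_mult p q - na_mult p' q"
  "na_mult p (q - q') = na_mult p q - na_mult p q'"
  "na_mult (pm_scale c p) q = pm_scale c (na_mult p q)"
  "na_mult p (pm_scale c q) = pm_scale c (na_mult p q)"
  by (rule poly_mapping_eqI;
      simp add: na_mult.rep_eq lookup_add lookup_minus algebra_simps split: word.split)+

inductive_set lie_ideal :: "('x word \<Rightarrow>\<^sub>0 'k::field) set" where
  zero: "0 \<in> lie_ideal"
| add: "p \<in> lie_ideal \<Longrightarrow> q \<in> lie_ideal \<Longrightarrow> p + q \<in> lie_ideal"
| scale: "p \<in> lie_ideal \<Longrightarrow> pm_scale c p \<in> lie_ideal"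
| left: "p \<in> lie_ideal \<Longrightarrow> na_mult q p \<in> lie_ideal"
| right: "p \<in> lie_ideal \<Longrightarrow> na_mult p q \<in> lie_ideal"
| square: "na_mult p p \<in> lie_ideal"
| jacobi: "na_mult (na_mult p q) r + na_mult (na_mult q r) p + na_mult (na_mult r p) q \<in> lie_ideal"

definition lie_rel :: "('x word \<Rightarrow>\<^sub>0 'k::field) \<Rightarrow> ('x word \<Rightarrow>\<^sub>0 'k) \<Rightarrow> bool"
  where "lie_rel p q \<longleftrightarrow> p - q \<in> lie_ideal"

lemma lie_ideal_uminus: "p \<in> lie_ideal \<Longrightarrow> - p \<in> lie_ideal"
  using lie_ideal.scale[of p "-1"] by simp

lemma lie_rel_equivp: "equivp (lie_rel :: ('x word \<Rightarrow>\<^sub>0 'k::field) \<Rightarrow> _)"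
proof (rule equivpI)
  show "reflp (lie_rel :: ('x word \<Rightarrow>\<^sub>0 'k) \<Rightarrow> _)" by (simp add: reflp_def lie_rel_def lie_ideal.zero)
  show "symp (lie_rel :: ('x word \<Rightarrow>\<^sub>0 'k) \<Rightarrow> _)"
    unfolding symp_def lie_rel_def using lie_ideal_uminus minus_diff_eq by metis
  show "transp (lie_rel :: ('x word \<Rightarrow>\<^sub>0 'k) \<Rightarrow> _)"
    unfolding transp_def lie_rel_def
  proof (intro allI impI)
    fix p q r :: "'x word \<Rightarrow>\<^sub>0 'k"
    assume "p - q \<in> lie_ideal" "q - r \<in> lie_ideal"
    from lie_ideal.add[OF this] show "p - r \<in> lie_ideal" by simp
  qed
qed

quotient_type (overloaded) ('x, 'k) free_lie = "'x word \<Rightarrow>\<^sub>0 'k::field" / lie_rel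
  by (rule lie_rel_equivp)

instantiation free_lie :: (type, field) ab_group_add
begin

lift_definition zero_free_lie :: "('a, 'b) free_lie" is 0 .

lift_definition plus_free_lie :: "('a, 'b) free_lie \<Rightarrow> ('a, 'b) free_lie \<Rightarrow> ('a, 'b) free_lie"
  is "(+)"
  unfolding lie_rel_def by (metis add_diff_add lie_ideal.add)

lift_definition uminus_free_lie :: "('a, 'b) free_lie \<Rightarrow> ('a, 'b) free_lie" is uminus
  unfolding lie_rel_def by (metis minus_diff_minus lie_ideal_uminus)

lift_definition minus_free_lie :: "('a, 'b) free_lie \<Rightarrow> ('a, 'b) free_lie \<Rightarrow> ('a, 'b) free_lie"
  is "(-)"
  unfolding lie_rel_def
proof -
  fix p p' q q' :: "'a word \<Rightarrow>\<^sub>0 'b"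
  assume "p - p' \<in> lie_ideal" "q - q' \<in> lie_ideal"
  from lie_ideal.add[OF this(1) lie_ideal_uminus[OF this(2)]]
  show "p - q - (p' - q') \<in> lie_ideal" by (simp add: algebra_simps)
qed

instance
  by standard (transfer; simp add: lie_rel_def lie_ideal.zero algebra_simps)+

end

lift_definition lie_scale :: "'k::field \<Rightarrow> ('x, 'k) free_lie \<Rightarrow> ('x, 'k) free_lie" is pm_scale
  unfolding lie_rel_def by (metis pm.scale_right_diff_distrib lie_ideal.scale)

lift_definition lie_bracket ::
  "('x, 'k::field) free_lie \<Rightarrow> ('x, 'k) free_lie \<Rightarrow> ('x, 'k) free_lie" is na_mult
  unfolding lie_rel_def
proof -
  fix p p' q q' :: "'x word \<Rightarrow>\<^sub>0 'k"
  assume "p - p' \<in> lie_ideal" "q - q' \<in> lie_ideal"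
  then have "na_mult (p - p') q + na_mult p' (q - q') \<in> lie_ideal"
    by (intro lie_ideal.add lie_ideal.left lie_ideal.right)
  then show "na_mult p q - na_mult p' q' \<in> lie_ideal"
    by (simp add: na_mult_bilinear)
qed

lift_definition lie_gen :: "'x \<Rightarrow> ('x, 'k::field) free_lie" is "\<lambda>x. Poly_Mapping.single (Gen x) 1" .

interpretation lie: vector_space "lie_scale :: 'k::field \<Rightarrow> ('x, 'k) free_lie \<Rightarrow> ('x, 'k) free_lie"
  by unfold_locales (transfer; simp add: lie_rel_def lie_ideal.zero algebra_simps
      pm.scale_right_distrib pm.scale_left_distrib)+

lemma lie_bracket_bilinear:
  "lie_bracket (a + a') b = lie_bracket a b + lie_bracket a' b"
  "lie_bracket a (b + b') = lie_bracket a b + lie_bracket a b'"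
  "lie_bracket (lie_scale c a) b = lie_scale c (lie_bracket a b)"
  "lie_bracket a (lie_scale c b) = lie_scale c (lie_bracket a b)"
  by (transfer; simp add: lie_rel_def lie_ideal.zero na_mult_bilinear)+

lemma lie_bracket_self: "lie_bracket a a = 0"
  by (transfer) (simp add: lie_rel_def lie_ideal.square)

lemma lie_bracket_jacobi:
  "lie_bracket (lie_bracket a b) c + lie_bracket (lie_bracket b c) a
    + lie_bracket (lie_bracket c a) b = 0"
  by (transfer) (simp add: lie_rel_def lie_ideal.jacobi)

lemma lie_bracket_anticomm: "lie_bracket a b = - lie_bracket b a"
proof -
  have "lie_bracket a b + lie_bracket b a = lie_bracket (a + b) (a + b)"
    unfolding lie_bracket_bilinear by (simp add: lie_bracket_self add.commute)
  also have "\<dots> = 0" by (rule lie_bracket_self)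
  finally have "lie_bracket a b + lie_bracket b a = 0" .
  then show ?thesis by (simp add: eq_neg_iff_add_eq_0)
qed

lemma lie_bracket_zero: "lie_bracket 0 b = 0" "lie_bracket a 0 = 0"
  using lie_bracket_bilinear(1)[of 0 0 b] lie_bracket_bilinear(2)[of a 0 0] by simp_all

lemma lie_bracket_uminus: "lie_bracket (- a) b = - lie_bracket a b" "lie_bracket a (- b) = - lie_bracket a b"
  using lie_bracket_bilinear(3)[of "-1" a b] lie_bracket_bilinear(4)[of a "-1" b] by simp_all

lemma lie_bracket_diff:
  "lie_bracket (a - a') b = lie_bracket a b - lie_bracket a' b"
  "lie_bracket a (b - b') = lie_bracket a b - lie_bracket a b'"
  using lie_bracket_bilinear(1)[of a "- a'" b] lie_bracket_bilinear(2)[of a b "- b'"]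
  by (simp_all add: lie_bracket_uminus)


section \<open>The free metabelian Lie algebra\<close>

definition lie_derived :: "('x, 'k::field) free_lie set"
  where "lie_derived = commutator_space lie_scale lie_bracket UNIV"

definition lie_derived2 :: "('x, 'k::field) free_lie set"
  where "lie_derived2 = commutator_space lie_scale lie_bracket lie_derived"

lemma subspace_lie_derived2: "lie.subspace lie_derived2"
  unfolding lie_derived2_def commutator_space_def by (rule lie.subspace_span)

lemma lie_bracket_in_derived: "lie_bracket a b \<in> lie_derived"
  unfolding lie_derived_def commutator_space_def by (rule lie.span_base) auto

lemma lie_bracket_in_derived2:
  "a \<in> lie_derived \<Longrightarrow> b \<in> lie_derived \<Longrightarrow> lie_bracket a b \<in> lie_derived2"
  unfolding lie_derived2_def commutator_space_def by (rule lie.span_base) auto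

lemma lie_derived2_ideal:
  assumes "a \<in> lie_derived2"
  shows "lie_bracket a c \<in> lie_derived2"
  using assms unfolding lie_derived2_def commutator_space_def
proof (induction rule: lie.span_induct_alt)
  case base
  then show ?case by (simp add: lie_bracket_zero lie.span_zero)
next
  case (step k x y)
  then obtain a b where x: "x = lie_bracket a b" "a \<in> lie_derived" "b \<in> lie_derived" by blast
  have "lie_bracket x c = lie_bracket (lie_bracket a c) b - lie_bracket (lie_bracket b c) a"
    using lie_bracket_jacobi[of a b c] unfolding x(1) lie_bracket_anticomm[of c a]
    by (simp add: lie_bracket_uminus algebra_simps eq_neg_iff_add_eq_0)
  also have "\<dots> \<in> lie_derived2"
    by (intro lie.subspace_diff subspace_lie_derived2 lie_bracket_in_derived2
        lie_bracket_in_derived x)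
  finally have "lie_bracket x c \<in> lie_derived2" .
  then show ?case
    using step(2) unfolding lie_derived2_def commutator_space_def
    by (simp add: lie_bracket_bilinear lie.span_add lie.span_scale)
qed

definition metab_rel :: "('x, 'k::field) free_lie \<Rightarrow> ('x, 'k) free_lie \<Rightarrow> bool"
  where "metab_rel a b \<longleftrightarrow> a - b \<in> lie_derived2"

lemmas lie_derived2_closed =
  lie.subspace_0[OF subspace_lie_derived2] lie.subspace_add[OF subspace_lie_derived2]
  lie.subspace_neg[OF subspace_lie_derived2] lie.subspace_diff[OF subspace_lie_derived2]
  lie.subspace_scale[OF subspace_lie_derived2]

lemma metab_rel_equivp: "equivp (metab_rel :: ('x, 'k::field) free_lie \<Rightarrow> _)"
proof (rule equivpI)
  show "reflp (metab_rel :: ('x, 'k) free_lie \<Rightarrow> _)" by (simp add: reflp_def metab_rel_def lie_derived2_closed)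
  show "symp (metab_rel :: ('x, 'k) free_lie \<Rightarrow> _)"
    unfolding symp_def metab_rel_def using lie_derived2_closed(3) minus_diff_eq by metis
  show "transp (metab_rel :: ('x, 'k) free_lie \<Rightarrow> _)"
    unfolding transp_def metab_rel_def
  proof (intro allI impI)
    fix p q r :: "('x, 'k) free_lie"
    assume "p - q \<in> lie_derived2" "q - r \<in> lie_derived2"
    from lie_derived2_closed(2)[OF this] show "p - r \<in> lie_derived2" by simp
  qed
qed

quotient_type (overloaded) ('x, 'k) free_metab = "('x, 'k::field) free_lie" / metab_rel
  by (rule metab_rel_equivp)

instantiation free_metab :: (type, field) ab_group_add
begin

lift_definition zero_free_metab :: "('a, 'b) free_metab" is 0 .

lift_definition plus_free_metab :: "('a, 'b) free_metab \<Rightarrow> ('a, 'b) free_metab \<Rightarrow> ('a, 'b) free_metab"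
  is "(+)"
  unfolding metab_rel_def by (metis add_diff_add lie_derived2_closed(2))

lift_definition uminus_free_metab :: "('a, 'b) free_metab \<Rightarrow> ('a, 'b) free_metab" is uminus
  unfolding metab_rel_def by (metis minus_diff_minus lie_derived2_closed(3))

lift_definition minus_free_metab :: "('a, 'b) free_metab \<Rightarrow> ('a, 'b) free_metab \<Rightarrow> ('a, 'b) free_metab"
  is "(-)"
  unfolding metab_rel_def
proof -
  fix p p' q q' :: "('a, 'b) free_lie"
  assume "p - p' \<in> lie_derived2" "q - q' \<in> lie_derived2"
  from lie_derived2_closed(4)[OF this]
  show "p - q - (p' - q') \<in> lie_derived2" by (simp add: algebra_simps)
qed

instance
  by standard (transfer; simp add: metab_rel_def lie_derived2_closed algebra_simps)+

end

lift_definition metab_scale :: "'k::field \<Rightarrow> ('x, 'k) free_metab \<Rightarrow> ('x, 'k) free_metab" is lie_scale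
  unfolding metab_rel_def by (metis lie.scale_right_diff_distrib lie_derived2_closed(5))

lift_definition metab_bracket ::
  "('x, 'k::field) free_metab \<Rightarrow> ('x, 'k) free_metab \<Rightarrow> ('x, 'k) free_metab" is lie_bracket
  unfolding metab_rel_def
proof -
  fix p p' q q' :: "('x, 'k) free_lie"
  assume *: "p - p' \<in> lie_derived2" "q - q' \<in> lie_derived2"
  have "lie_bracket (p - p') q - lie_bracket (q - q') p' \<in> lie_derived2"
    by (intro lie_derived2_closed lie_derived2_ideal *)
  moreover have "lie_bracket (q - q') p' = - lie_bracket p' (q - q')"
    by (rule lie_bracket_anticomm)
  ultimately show "lie_bracket p q - lie_bracket p' q' \<in> lie_derived2"
    by (simp add: lie_bracket_diff)
qed

lift_definition metab_gen :: "'x \<Rightarrow> ('x, 'k::field) free_metab" is lie_gen .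

interpretation metab: vector_space
  "metab_scale :: 'k::field \<Rightarrow> ('x, 'k) free_metab \<Rightarrow> ('x, 'k) free_metab"
  by unfold_locales (transfer; simp add: metab_rel_def lie_derived2_closed algebra_simps
      lie.scale_right_distrib lie.scale_left_distrib)+

abbreviation metab_commutator :: "('x, 'k::field) free_metab set \<Rightarrow> ('x, 'k) free_metab set"
  where "metab_commutator \<equiv> commutator_space metab_scale metab_bracket"

definition metab_subalg :: "'x set \<Rightarrow> ('x, 'k::field) free_metab set"
  where "metab_subalg Y = generated_subalgebra metab_scale metab_bracket (metab_gen ` Y)"

primrec metab_word :: "'x word \<Rightarrow> ('x, 'k::field) free_metab" where
  "metab_word (Gen x) = metab_gen x"
| "metab_word (Br a b) = metab_bracket (metab_word a) (metab_word b)"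


section \<open>Polynomials and their action\<close>

type_synonym 'x monom = "'x \<Rightarrow>\<^sub>0 nat"
type_synonym ('x, 'k) pol = "('x \<Rightarrow>\<^sub>0 nat) \<Rightarrow>\<^sub>0 'k"

definition pol_monom :: "'x monom \<Rightarrow> ('x, 'k::field) pol"
  where "pol_monom m = Poly_Mapping.single m 1"

definition pol_var :: "'x \<Rightarrow> ('x, 'k::field) pol"
  where "pol_var x = pol_monom (Poly_Mapping.single x 1)"

definition pol_ring :: "'x set \<Rightarrow> ('x, 'k::field) pol set"
  where "pol_ring Y = {f. \<forall>m \<in> Poly_Mapping.keys f. Poly_Mapping.keys m \<subseteq> Y}"

definition aug_ideal :: "'x set \<Rightarrow> ('x, 'k::field) pol set"
  where "aug_ideal Y = {f \<in> pol_ring Y. Poly_Mapping.lookup f 0 = 0}"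

definition monom_act ::
  "('x::linorder, 'k::field) free_metab \<Rightarrow> 'x monom \<Rightarrow> ('x, 'k) free_metab"
  where "monom_act u m =
    fold (\<lambda>x. (\<lambda>w. metab_bracket w (metab_gen x)) ^^ Poly_Mapping.lookup m x)
      (sorted_list_of_set (Poly_Mapping.keys m)) u"

text \<open>
  The order in which \<open>monom_act\<close> applies the adjoint operators is only relevant for
  \<open>u\<close> outside the commutator ideal, where polynomials are never applied below.
\<close>

definition pol_act ::
  "('x::linorder, 'k::field) free_metab \<Rightarrow> ('x, 'k) pol \<Rightarrow> ('x, 'k) free_metab"
  where "pol_act u f =
    (\<Sum>m\<in>Poly_Mapping.keys f. metab_scale (Poly_Mapping.lookup f m) (monom_act u m))"

text \<open>
  In \<open>pi_monom\<close>, the summands belonging to equal factors of the monomial are collected: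
  \<open>x\<close> occurs \<open>lookup m x\<close> times, and removing one occurrence leaves \<open>m - single x 1\<close>.
\<close>

definition pi_monom :: "'x::linorder \<Rightarrow> 'x monom \<Rightarrow> ('x, 'k::field) free_metab"
  where "pi_monom z m =
    (\<Sum>x\<in>Poly_Mapping.keys m. metab_scale (of_nat (Poly_Mapping.lookup m x))
      (pol_act (metab_bracket (metab_gen z) (metab_gen x))
        (pol_monom (m - Poly_Mapping.single x 1))))"

definition pi_map :: "'x::linorder \<Rightarrow> ('x, 'k::field) pol \<Rightarrow> ('x, 'k) free_metab"
  where "pi_map z f =
    (\<Sum>m\<in>Poly_Mapping.keys f. metab_scale (Poly_Mapping.lookup f m) (pi_monom z m))"


section \<open>Gradings\<close>

primrec word_weight :: "('x \<Rightarrow> 'g::comm_monoid_add) \<Rightarrow> 'x word \<Rightarrow> 'g" where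
  "word_weight wt (Gen x) = wt x"
| "word_weight wt (Br a b) = word_weight wt a + word_weight wt b"

definition monom_weight :: "('x \<Rightarrow> 'g::comm_monoid_add) \<Rightarrow> 'x monom \<Rightarrow> 'g"
  where "monom_weight wt m = (\<Sum>x\<in>Poly_Mapping.keys m. \<Sum>_<Poly_Mapping.lookup m x. wt x)"

definition metab_homogeneous ::
  "('x \<Rightarrow> 'g::comm_monoid_add) \<Rightarrow> ('x, 'k::field) free_metab \<Rightarrow> bool"
  where "metab_homogeneous wt v \<longleftrightarrow>
    (\<exists>g. v \<in> metab.span {metab_word w | w. word_weight wt w = g})"

definition pol_homogeneous ::
  "('x \<Rightarrow> 'g::comm_monoid_add) \<Rightarrow> ('x, 'k::field) pol \<Rightarrow> bool"
  where "pol_homogeneous wt f \<longleftrightarrow> (\<exists>g. \<forall>m\<in>Poly_Mapping.keys f. monom_weight wt m = g)"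

definition total_degree :: "'x \<Rightarrow> int"
  where "total_degree x = 1"


section \<open>Weitzenboeck derivations\<close>

text \<open>\<open>KX\<close> is rendered as \<open>'x \<Rightarrow>\<^sub>0 'k\<close> with basis \<open>kx\<close>.\<close>

definition kx :: "'x \<Rightarrow> ('x \<Rightarrow>\<^sub>0 'k::field)"
  where "kx x = Poly_Mapping.single x 1"

definition pol_linear :: "('x \<Rightarrow>\<^sub>0 'k::field) \<Rightarrow> ('x, 'k) pol"
  where "pol_linear v = (\<Sum>x\<in>Poly_Mapping.keys v. pm_scale (Poly_Mapping.lookup v x) (pol_var x))"

definition metab_linear :: "('x \<Rightarrow>\<^sub>0 'k::field) \<Rightarrow> ('x, 'k) free_metab"
  where "metab_linear v =
    (\<Sum>x\<in>Poly_Mapping.keys v. metab_scale (Poly_Mapping.lookup v x) (metab_gen x))"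

text \<open>
  A nonzero nilpotent operator \<open>\<delta>\<close> of \<open>KX\<close> together with its (unique) extensions \<open>DP\<close> and \<open>DL\<close>
  to derivations of the polynomial algebra and of the free metabelian Lie algebra.
\<close>

definition weitzenboeck ::
  "(('x \<Rightarrow>\<^sub>0 'k::field) \<Rightarrow> ('x \<Rightarrow>\<^sub>0 'k)) \<Rightarrow> (('x, 'k) pol \<Rightarrow> ('x, 'k) pol)
    \<Rightarrow> (('x, 'k) free_metab \<Rightarrow> ('x, 'k) free_metab) \<Rightarrow> bool"
  where "weitzenboeck \<delta> DP DL \<longleftrightarrow>
    Vector_Spaces.linear pm_scale pm_scale \<delta> \<and> \<delta> \<noteq> (\<lambda>_. 0) \<and> (\<exists>n. \<delta> ^^ n = (\<lambda>_. 0)) \<and>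
    derivation pm_scale (*) DP \<and> (\<forall>v. DP (pol_linear v) = pol_linear (\<delta> v)) \<and>
    derivation metab_scale metab_bracket DL \<and> (\<forall>v. DL (metab_linear v) = metab_linear (\<delta> v))"

text \<open>
  The list \<open>cells\<close> splits the increasing list of all variables into the consecutive blocks
  corresponding to the Jordan cells.
\<close>

definition jordan_basis ::
  "(('x::{finite,linorder} \<Rightarrow>\<^sub>0 'k::field) \<Rightarrow> ('x \<Rightarrow>\<^sub>0 'k)) \<Rightarrow> 'x list list \<Rightarrow> bool"
  where "jordan_basis \<delta> cells \<longleftrightarrow>
    concat cells = sorted_list_of_set UNIV \<and>
    (\<forall>c\<in>set cells. c \<noteq> [] \<and> \<delta> (kx (c ! 0)) = 0 \<and>
      (\<forall>k. Suc k < length c \<longrightarrow> (\<exists>a. a \<noteq> 0 \<and> \<delta> (kx (c ! Suc k)) = pm_scale a (kx (c ! k)))))"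

definition bidegree :: "'x list list \<Rightarrow> 'x \<Rightarrow> int \<times> int"
  where "bidegree cells x =
    (THE g. \<exists>c\<in>set cells. \<exists>k<length c. c ! k = x \<and> g = (int (length c) - 1 - int k, int k))"

end

theory Submission
  imports Defs
begin

text \<open>
  Write \<open>z\<close> for the variable with the trivial Jordan cell, \<open>M\<close> for the commutator ideal, \<open>N\<close> for that
  of the subalgebra without \<open>z\<close>, and \<open>\<omega>\<close> for the augmentation ideal without \<open>z\<close>. The point is the
  decomposition \<open>M = \<Oplus>\<^sub>n N z\<^sup>n \<oplus> \<Oplus>\<^sub>n \<pi>(\<omega>) z\<^sup>n\<close>, which \<open>\<delta>\<close> respects, because \<open>\<pi>\<close> is a derivation and
  \<open>\<delta>(z) = 0\<close>; hence kernels can be taken summand by summand.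

  Let \<open>\<pi>\<^sub>a\<close> be the analogue of \<open>\<pi> = \<pi>\<^sub>z\<close> for a variable \<open>a\<close>. For a monomial \<open>m\<close>, the Jacobi identity
  gives \<open>\<pi>\<^sub>a(m) b - \<pi>\<^sub>b(m) a = deg(m) [a,b] m\<close>. For \<open>a = z\<close> this writes \<open>[z,b] m\<close> as a combination of
  \<open>\<pi>(m b)\<close> and \<open>\<pi>\<^sub>b(m) z \<in> N z\<close>, so that the sum is all of \<open>M\<close>. That it is direct is seen with the
  Magnus embedding, whose \<open>z\<close>-coordinate vanishes on \<open>N\<close> and is the Euler operator after \<open>\<pi>\<close>.
\<close>


section \<open>Families in direct sums of kernels\<close>

text \<open>Lets coefficients be indexed by the family instead of its image. Injectivity is
  recovered by testing on two equal vectors with coefficients 1 and -1.\<close>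

lemma (in vector_space) independent_family_iff:
  "inj_on v I \<and> independent (v ` I) \<longleftrightarrow>
    (\<forall>F c. finite F \<longrightarrow> F \<subseteq> I \<longrightarrow> (\<Sum>i\<in>F. c i *s v i) = 0 \<longrightarrow> (\<forall>i\<in>F. c i = 0))"
  (is "_ \<longleftrightarrow> ?indep")
proof (intro iffI conjI)
  assume *: "inj_on v I \<and> independent (v ` I)"
  show ?indep
  proof (intro allI impI ballI)
    fix F c i
    assume F: "finite F" "F \<subseteq> I" "(\<Sum>i\<in>F. c i *s v i) = 0" and i: "i \<in> F"
    have inj: "inj_on v F" using * F(2) inj_on_subset by blast
    have "(\<Sum>x\<in>v ` F. c (inv_into F v x) *s x) = (\<Sum>i\<in>F. c i *s v i)"
      using inj by (simp add: sum.reindex)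
    then have sum: "(\<Sum>x\<in>v ` F. c (inv_into F v x) *s x) = 0" using F(3) by simp
    have "c (inv_into F v (v i)) = 0"
      using * F i by (intro independentD[of "v ` I" "v ` F" "\<lambda>x. c (inv_into F v x)" "v i"] sum) auto
    then show "c i = 0" using inj i by simp
  qed
next
  assume *: ?indep
  show inj: "inj_on v I"
  proof (rule inj_onI, rule ccontr)
    fix i j assume ij: "i \<in> I" "j \<in> I" "v i = v j" "i \<noteq> j"
    have "(\<Sum>k\<in>{i, j}. (if k = i then 1 else - 1) *s v k) = 0" using ij by simp
    then show False using *[rule_format, of "{i, j}" "\<lambda>k. if k = i then 1 else - 1" i] ij by simp
  qed
  show "independent (v ` I)"
    unfolding independent_explicit_module
  proof (intro allI impI)
    fix t c x
    assume t: "finite t" "t \<subseteq> v ` I" "(\<Sum>x\<in>t. c x *s x) = 0" "x \<in> t"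
    obtain F where F: "F \<subseteq> I" "inj_on v F" "t = v ` F"
      using t(2) by (auto simp: subset_image_inj)
    have "finite F" using t(1) F by (simp add: finite_image_iff)
    moreover have "(\<Sum>i\<in>F. c (v i) *s v i) = 0" using t(3) F by (simp add: sum.reindex)
    ultimately have "\<forall>i\<in>F. c (v i) = 0" using F(1) * [rule_format, of F "\<lambda>i. c (v i)"] by blast
    then show "c x = 0" using t(4) F(3) by blast
  qed
qed

text \<open>Abstract core: \<open>D\<close> acts on the \<open>n\<close>-th copies of
  \<open>A\<close> and \<open>B\<close> through \<open>D1\<close> and \<open>D2\<close>, so by
  directness it kills a sum exactly when it kills every component. Bases of the two kernels then
  give a basis by taking all their copies. Directness is phrased for finite partial sums of
  sequences, which also yields injectivity of each \<open>\<alpha> n\<close> on \<open>A\<close> and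
  \<open>\<beta> n\<close> on \<open>B\<close>.\<close>

lemma basis_family_kernel_direct_sum:
  fixes s1 :: "'k::field \<Rightarrow> 'a::ab_group_add \<Rightarrow> 'a" and s2 :: "'k \<Rightarrow> 'b::ab_group_add \<Rightarrow> 'b"
    and s3 :: "'k \<Rightarrow> 'c::ab_group_add \<Rightarrow> 'c" and \<alpha> :: "nat \<Rightarrow> 'a \<Rightarrow> 'c" and \<beta> :: "nat \<Rightarrow> 'b \<Rightarrow> 'c"
  assumes lin: "\<And>n. Vector_Spaces.linear s1 s3 (\<alpha> n)" "\<And>n. Vector_Spaces.linear s2 s3 (\<beta> n)"
    and sub: "module.subspace s1 A" "module.subspace s2 B"
    and direct: "\<And>N a b. (\<And>n. a n \<in> A) \<Longrightarrow> (\<And>n. b n \<in> B) \<Longrightarrow>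
      (\<Sum>n<N. \<alpha> n (a n) + \<beta> n (b n)) = 0 \<Longrightarrow> \<forall>n<N. a n = 0 \<and> b n = 0"
    and W: "W = module.span s3 ((\<Union>n. \<alpha> n ` A) \<union> (\<Union>n. \<beta> n ` B))"
    and D: "Vector_Spaces.linear s3 s3 D"
    and DA: "\<And>n a. a \<in> A \<Longrightarrow> D (\<alpha> n a) = \<alpha> n (D1 a)" "\<And>a. a \<in> A \<Longrightarrow> D1 a \<in> A"
    and DB: "\<And>n b. b \<in> B \<Longrightarrow> D (\<beta> n b) = \<beta> n (D2 b)" "\<And>b. b \<in> B \<Longrightarrow> D2 b \<in> B"
    and v: "basis_family s1 I v (kernel_in D1 A)"
    and u: "basis_family s2 J u (kernel_in D2 B)"
  shows "basis_family s3 ((I \<times> UNIV) <+> (J \<times> UNIV))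
    (case_sum (\<lambda>(i, n). \<alpha> n (v i)) (\<lambda>(j, n). \<beta> n (u j))) (kernel_in D W)"
proof -
  interpret L1: Vector_Spaces.linear s1 s3 "\<alpha> n" for n by (rule lin)
  interpret L2: Vector_Spaces.linear s2 s3 "\<beta> n" for n by (rule lin)
  interpret D: Vector_Spaces.linear s3 s3 D by (rule D)
  define e where "e = case_sum (\<lambda>(i, n). \<alpha> n (v i)) (\<lambda>(j, n). \<beta> n (u j))"
  define K :: "('d \<times> nat + 'e \<times> nat) set" where "K = (I \<times> UNIV) <+> (J \<times> UNIV)"
  have vI: "L1.vs1.span (v ` I) = kernel_in D1 A" and uJ: "L2.vs1.span (u ` J) = kernel_in D2 B"
    using v u by (simp_all add: basis_family_def)
  have v_ker: "v i \<in> A" "D1 (v i) = 0" if "i \<in> I" for i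
    using L1.vs1.span_base[of "v i" "v ` I"] that vI by (auto simp: kernel_in_def)
  have u_ker: "u j \<in> B" "D2 (u j) = 0" if "j \<in> J" for j
    using L2.vs1.span_base[of "u j" "u ` J"] that uJ by (auto simp: kernel_in_def)
  have v_indep: "\<And>F c. finite F \<Longrightarrow> F \<subseteq> I \<Longrightarrow> (\<Sum>i\<in>F. s1 (c i) (v i)) = 0 \<Longrightarrow> \<forall>i\<in>F. c i = 0"
    using v L1.vs1.independent_family_iff[of v I] unfolding basis_family_def by blast
  have u_indep: "\<And>F c. finite F \<Longrightarrow> F \<subseteq> J \<Longrightarrow> (\<Sum>i\<in>F. s2 (c i) (u i)) = 0 \<Longrightarrow> \<forall>i\<in>F. c i = 0"
    using u L2.vs1.independent_family_iff[of u J] unfolding basis_family_def by blast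

  have "inj_on e K \<and> L1.vs2.independent (e ` K)"
    unfolding L1.vs2.independent_family_iff
  proof (intro allI impI ballI)
    fix F c x
    assume F: "finite F" "F \<subseteq> K" "(\<Sum>x\<in>F. s3 (c x) (e x)) = 0" and x: "x \<in> F"
    define I0 where "I0 = {i. \<exists>n. Inl (i, n) \<in> F}"
    define J0 where "J0 = {j. \<exists>n. Inr (j, n) \<in> F}"
    \<comment> \<open>Extending the coefficients by zero lets the sum run over full rectangles of
      indices, where it can be regrouped by the exponent \<open>n\<close>.\<close>
    define c' where "c' = (\<lambda>x. if x \<in> F then c x else 0)"
    define ix where "ix = (case_sum snd snd :: 'd \<times> nat + 'e \<times> nat \<Rightarrow> nat)"
    \<comment> \<open>\<open>ix\<close> reads off the exponent; \<open>Suc\<close> makes the bound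
      strict, as the sums run over \<open>n < N\<close>.\<close>
    define N where "N = Suc (Max (ix ` F))"
    have ix: "ix y < N" if "y \<in> F" for y
      using that F(1) unfolding N_def by (simp add: le_imp_less_Suc)
    have "I0 \<subseteq> (\<lambda>y. fst (projl y)) ` F" by (force simp: I0_def)
    then have I0: "finite I0" "I0 \<subseteq> I"
      using F(1) by (rule finite_subset[OF _ finite_imageI], use F(2) in \<open>auto simp: I0_def K_def\<close>)
    have "J0 \<subseteq> (\<lambda>y. fst (projr y)) ` F" by (force simp: J0_def)
    then have J0: "finite J0" "J0 \<subseteq> J"
      using F(1) by (rule finite_subset[OF _ finite_imageI], use F(2) in \<open>auto simp: J0_def K_def\<close>)
    have F_sub: "F \<subseteq> (I0 \<times> {..<N}) <+> (J0 \<times> {..<N})"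
    proof
      fix y assume y: "y \<in> F"
      then show "y \<in> (I0 \<times> {..<N}) <+> (J0 \<times> {..<N})"
        using ix[OF y] F(2) by (cases y) (auto simp: I0_def J0_def ix_def)
    qed
    define a where "a = (\<lambda>n. \<Sum>i\<in>I0. s1 (c' (Inl (i, n))) (v i))"
    define b where "b = (\<lambda>n. \<Sum>j\<in>J0. s2 (c' (Inr (j, n))) (u j))"
    have "0 = (\<Sum>x\<in>F. s3 (c x) (e x))" using F(3) by simp
    also have "\<dots> = (\<Sum>x\<in>(I0 \<times> {..<N}) <+> (J0 \<times> {..<N}). s3 (c' x) (e x))"
      using F_sub I0(1) J0(1) by (intro sum.mono_neutral_cong_left) (auto simp: c'_def)
    also have "\<dots> = (\<Sum>i\<in>I0. \<Sum>n<N. s3 (c' (Inl (i, n))) (\<alpha> n (v i)))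
        + (\<Sum>j\<in>J0. \<Sum>n<N. s3 (c' (Inr (j, n))) (\<beta> n (u j)))"
      using I0(1) J0(1) by (simp add: sum.Plus sum.cartesian_product e_def case_prod_unfold)
    also have "\<dots> = (\<Sum>n<N. \<Sum>i\<in>I0. s3 (c' (Inl (i, n))) (\<alpha> n (v i)))
        + (\<Sum>n<N. \<Sum>j\<in>J0. s3 (c' (Inr (j, n))) (\<beta> n (u j)))"
      by (simp only: sum.swap[of _ "{..<N}"])
    also have "\<dots> = (\<Sum>n<N. \<alpha> n (a n) + \<beta> n (b n))"
      by (simp add: a_def b_def L1.sum L2.sum L1.scale L2.scale sum.distrib)
    finally have "(\<Sum>n<N. \<alpha> n (a n) + \<beta> n (b n)) = 0" by simp
    moreover have "a n \<in> A" for n unfolding a_def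
      using I0(2) by (intro L1.vs1.subspace_sum L1.vs1.subspace_scale sub(1) v_ker) auto
    moreover have "b n \<in> B" for n unfolding b_def
      using J0(2) by (intro L2.vs1.subspace_sum L2.vs1.subspace_scale sub(2) u_ker) auto
    ultimately have ab: "\<forall>n<N. a n = 0 \<and> b n = 0" using direct by blast
    have c0: "\<forall>i\<in>I0. c' (Inl (i, n)) = 0" "\<forall>j\<in>J0. c' (Inr (j, n)) = 0" if "n < N" for n
      using that ab v_indep[OF I0, of "\<lambda>i. c' (Inl (i, n))"] u_indep[OF J0, of "\<lambda>j. c' (Inr (j, n))"]
      by (auto simp: a_def b_def)
    have "c' x = 0" using F_sub x c0 by blast
    then show "c x = 0" using x by (simp add: c'_def)
  qed
  moreover have "L1.vs2.span (e ` K) = kernel_in D W"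
  proof (intro antisym L1.vs2.span_minimal subsetI)
    fix w assume "w \<in> e ` K"
    then consider i n where "i \<in> I" "w = \<alpha> n (v i)" | j n where "j \<in> J" "w = \<beta> n (u j)"
      by (auto simp: e_def K_def)
    then show "w \<in> kernel_in D W"
    proof cases
      case 1
      then show ?thesis using v_ker[of i] unfolding W kernel_in_def
        by (auto simp: DA L1.zero intro!: L1.vs2.span_base)
    next
      case 2
      then show ?thesis using u_ker[of j] unfolding W kernel_in_def
        by (auto simp: DB L2.zero intro!: L1.vs2.span_base)
    qed
  next
    show "L1.vs2.subspace (kernel_in D W)"
      unfolding W kernel_in_def L1.vs2.subspace_def
      by (auto simp: D.zero D.add D.scale L1.vs2.span_zero L1.vs2.span_add L1.vs2.span_scale)
  next
    fix w assume w: "w \<in> kernel_in D W"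
    \<comment> \<open>Each element of the span has finitely supported components. Vanishing from
      \<open>N\<close> on is carried through the induction so that the sum can be lengthened when a
      summand with a larger exponent is added.\<close>
    have "\<exists>N a b. (\<forall>n. a n \<in> A) \<and> (\<forall>n. b n \<in> B) \<and> (\<forall>n\<ge>N. a n = 0 \<and> b n = 0) \<and>
        w = (\<Sum>n<N. \<alpha> n (a n) + \<beta> n (b n))"
    proof -
      have add: "\<exists>N a b. (\<forall>n. a n \<in> A) \<and> (\<forall>n. b n \<in> B) \<and> (\<forall>n\<ge>N. a n = 0 \<and> b n = 0) \<and>
          \<alpha> m x + \<beta> m y + w' = (\<Sum>n<N. \<alpha> n (a n) + \<beta> n (b n))"
        if x: "x \<in> A" and y: "y \<in> B" and ab: "\<forall>n. a n \<in> A" "\<forall>n. b n \<in> B"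
          "\<forall>n\<ge>N. a n = 0 \<and> b n = 0" "w' = (\<Sum>n<N. \<alpha> n (a n) + \<beta> n (b n))"
        for m x y w' N a b
      proof -
        define N' where "N' = max N (Suc m)"
        have w': "w' = (\<Sum>n<N'. \<alpha> n (a n) + \<beta> n (b n))" unfolding ab(4) N'_def
          using ab(3) by (intro sum.mono_neutral_left) (auto simp: L1.zero L2.zero)
        have "(\<Sum>n<N'. \<alpha> n ((a(m := a m + x)) n) + \<beta> n ((b(m := b m + y)) n))
            = (\<Sum>n<N'. (\<alpha> n (a n) + \<beta> n (b n)) + (if n = m then \<alpha> m x + \<beta> m y else 0))"
          by (intro sum.cong) (auto simp: L1.add L2.add algebra_simps)
        also have "\<dots> = w' + (\<alpha> m x + \<beta> m y)"
        proof -
          have "m < N'" by (simp add: N'_def)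
          then show ?thesis by (simp add: sum.distrib w')
        qed
        finally show ?thesis
          using x y ab(1-3) L1.vs1.subspace_add[OF sub(1)] L2.vs1.subspace_add[OF sub(2)]
          by (intro exI[of _ N'] exI[of _ "a(m := a m + x)"] exI[of _ "b(m := b m + y)"])
             (auto simp: N'_def algebra_simps)
      qed
      from w have "w \<in> W" by (simp add: kernel_in_def)
      then show ?thesis unfolding W
      proof (induction rule: L1.vs2.span_induct_alt)
        case base
        show ?case using L1.vs1.subspace_0[OF sub(1)] L2.vs1.subspace_0[OF sub(2)]
          by (intro exI[of _ 0] exI[of _ "\<lambda>_. 0"]) auto
      next
        case (step k p q)
        from step(2) obtain N a b where ab: "\<forall>n. a n \<in> A" "\<forall>n. b n \<in> B"
          "\<forall>n\<ge>N. a n = 0 \<and> b n = 0" "q = (\<Sum>n<N. \<alpha> n (a n) + \<beta> n (b n))" by blast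
        from step(1) consider n x where "x \<in> A" "p = \<alpha> n x" | n y where "y \<in> B" "p = \<beta> n y"
          by blast
        then show ?case
        proof cases
          case 1
          have eq: "s3 k p = \<alpha> n (s1 k x) + \<beta> n 0"
            unfolding 1(2) L1.scale L2.zero by simp
          show ?thesis unfolding eq
            using 1 by (intro add[OF _ _ ab] L1.vs1.subspace_scale sub L2.vs1.subspace_0)
        next
          case 2
          have eq: "s3 k p = \<alpha> n 0 + \<beta> n (s2 k y)"
            unfolding 2(2) L2.scale L1.zero by simp
          show ?thesis unfolding eq
            using 2 by (intro add[OF _ _ ab] L2.vs1.subspace_scale sub L1.vs1.subspace_0)
        qed
      qed
    qed
    then obtain N a b where ab: "\<And>n. a n \<in> A" "\<And>n. b n \<in> B"
      and w_eq: "w = (\<Sum>n<N. \<alpha> n (a n) + \<beta> n (b n))" by blast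
    \<comment> \<open>Since \<open>D1\<close> and \<open>D2\<close> preserve \<open>A\<close> and
      \<open>B\<close>, this is a decomposition of the same type, so directness applies to
      \<open>D w\<close> as well.\<close>
    have "D w = (\<Sum>n<N. \<alpha> n (D1 (a n)) + \<beta> n (D2 (b n)))"
      by (simp add: w_eq D.sum D.add DA DB ab)
    then have "(\<Sum>n<N. \<alpha> n (D1 (a n)) + \<beta> n (D2 (b n))) = 0"
      using w by (simp add: kernel_in_def)
    then have "\<forall>n<N. D1 (a n) = 0 \<and> D2 (b n) = 0"
      using direct[of "\<lambda>n. D1 (a n)" "\<lambda>n. D2 (b n)" N] DA(2) DB(2) ab by blast
    then have ker: "a n \<in> L1.vs1.span (v ` I)" "b n \<in> L2.vs1.span (u ` J)" if "n < N" for n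
      using that ab by (auto simp: vI uJ kernel_in_def)
    have "\<alpha> n ` v ` I \<subseteq> e ` K" "\<beta> n ` u ` J \<subseteq> e ` K" for n
      by (auto simp: e_def K_def intro: image_eqI[of _ _ "Inl (_, n)"] image_eqI[of _ _ "Inr (_, n)"])
    then have "L1.vs2.span (\<alpha> n ` v ` I) \<subseteq> L1.vs2.span (e ` K)"
      "L1.vs2.span (\<beta> n ` u ` J) \<subseteq> L1.vs2.span (e ` K)" for n
      by (simp_all only: L1.vs2.span_mono)
    then have "\<alpha> n (a n) \<in> L1.vs2.span (e ` K)" "\<beta> n (b n) \<in> L1.vs2.span (e ` K)" if "n < N" for n
      using ker[OF that] unfolding L1.span_image L2.span_image by blast+
    then show "w \<in> L1.vs2.span (e ` K)"
      unfolding w_eq by (intro L1.vs2.span_sum L1.vs2.span_add) auto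
  qed
  ultimately show ?thesis unfolding basis_family_def e_def K_def by blast
qed


section \<open>Linear maps out of free vector spaces\<close>

definition lin_ext :: "('k::field \<Rightarrow> 'b::ab_group_add \<Rightarrow> 'b) \<Rightarrow> ('a \<Rightarrow> 'b) \<Rightarrow> ('a \<Rightarrow>\<^sub>0 'k) \<Rightarrow> 'b"
  where "lin_ext s h p = (\<Sum>a\<in>Poly_Mapping.keys p. s (Poly_Mapping.lookup p a) (h a))"

context vector_space
begin

lemma lin_ext_superset:
  assumes "finite A" "Poly_Mapping.keys p \<subseteq> A"
  shows "lin_ext scale h p = (\<Sum>a\<in>A. Poly_Mapping.lookup p a *s h a)"
  unfolding lin_ext_def using assms
  by (intro sum.mono_neutral_left) (auto simp: in_keys_iff)

lemma linear_lin_ext: "Vector_Spaces.linear pm_scale scale (lin_ext scale h)"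
proof -
  have "lin_ext scale h (p + q) = lin_ext scale h p + lin_ext scale h q" for p q
  proof -
    let ?A = "Poly_Mapping.keys p \<union> Poly_Mapping.keys q"
    have "lin_ext scale h r = (\<Sum>a\<in>?A. Poly_Mapping.lookup r a *s h a)" if "r \<in> {p, q, p + q}" for r
      using that by (intro lin_ext_superset) (use keys_add[of p q] in auto)
    then show ?thesis by (simp add: lookup_add scale_left_distrib sum.distrib)
  qed
  moreover have "lin_ext scale h (pm_scale c p) = c *s lin_ext scale h p" for c p
  proof -
    have "lin_ext scale h (pm_scale c p)
        = (\<Sum>a\<in>Poly_Mapping.keys p. Poly_Mapping.lookup (pm_scale c p) a *s h a)"
      by (intro lin_ext_superset) (auto simp: in_keys_iff)
    then show ?thesis by (simp add: lin_ext_def scale_sum_right)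
  qed
  ultimately show ?thesis
    by (simp add: Vector_Spaces.linear_iff pm.vector_space_axioms vector_space_axioms)
qed

lemma lin_ext_single [simp]: "lin_ext scale h (Poly_Mapping.single a c) = c *s h a"
  by (simp add: lin_ext_def)

text \<open>Agreement is asked only on the support of \<open>p\<close>, so that identities valid for
  polynomials in some of the variables can also be checked on monomials.\<close>

lemma linear_eq_on_keys:
  assumes f: "Vector_Spaces.linear pm_scale scale f" and g: "Vector_Spaces.linear pm_scale scale g"
    and eq: "\<And>a. a \<in> Poly_Mapping.keys p \<Longrightarrow>
      f (Poly_Mapping.single a 1) = g (Poly_Mapping.single a 1)"
  shows "f p = g p"
proof -
  interpret f: Vector_Spaces.linear pm_scale scale f by (rule f)
  interpret g: Vector_Spaces.linear pm_scale scale g by (rule g)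
  have p: "p = lin_ext pm_scale (\<lambda>a. Poly_Mapping.single a 1) p"
    by (rule poly_mapping_eqI) (auto simp: lin_ext_def lookup_sum lookup_single when_def in_keys_iff
        if_distrib[of "(*) _"] cong: if_cong)
  show ?thesis
    by (subst p, subst (2) p) (simp add: lin_ext_def f.sum g.sum f.scale g.scale eq)
qed

end

lemma pm_scale_mult:
  fixes p q :: "'a::comm_monoid_add \<Rightarrow>\<^sub>0 'k::field"
  shows "pm_scale c p * q = pm_scale c (p * q)" "p * pm_scale c q = pm_scale c (p * q)"
  by (simp_all add: pm_scale_def mult_map_scale_conv_mult mult_ac)


section \<open>The action of polynomials on the commutator ideal\<close>

lemma metab_bracket_bilinear:
  "metab_bracket (a + a') b = metab_bracket a b + metab_bracket a' b"
  "metab_bracket a (b + b') = metab_bracket a b + metab_bracket a b'"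
  "metab_bracket (metab_scale c a) b = metab_scale c (metab_bracket a b)"
  "metab_bracket a (metab_scale c b) = metab_scale c (metab_bracket a b)"
  by (transfer; simp add: metab_rel_def lie_derived2_closed lie_bracket_bilinear)+

lemma metab_bracket_self [simp]: "metab_bracket a a = 0"
  by transfer (simp add: metab_rel_def lie_derived2_closed lie_bracket_self)

lemma metab_bracket_jacobi:
  "metab_bracket (metab_bracket a b) c + metab_bracket (metab_bracket b c) a
    + metab_bracket (metab_bracket c a) b = 0"
  by transfer (simp add: metab_rel_def lie_derived2_closed lie_bracket_jacobi)

lemma metab_bracket_anticomm: "metab_bracket a b = - metab_bracket b a"
  by transfer (metis lie_bracket_anticomm metab_rel_def lie_derived2_closed(1) diff_self)

lemma linear_metab_bracket:
  "Vector_Spaces.linear metab_scale metab_scale (\<lambda>a. metab_bracket a b)"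
  "Vector_Spaces.linear metab_scale metab_scale (metab_bracket a)"
  by (simp_all add: Vector_Spaces.linear_iff metab.vector_space_axioms metab_bracket_bilinear)

interpretation metab_ad: Vector_Spaces.linear metab_scale metab_scale "\<lambda>a. metab_bracket a b"
  for b :: "('x, 'k::field) free_metab"
  by (rule linear_metab_bracket)

interpretation metab_ad_left: Vector_Spaces.linear metab_scale metab_scale "metab_bracket a"
  for a :: "('x, 'k::field) free_metab"
  by (rule linear_metab_bracket)

abbreviation metab_derived :: "('x, 'k::field) free_metab set"
  where "metab_derived \<equiv> metab_commutator UNIV"

lemma subspace_commutator: "metab.subspace (metab_commutator S)"
  unfolding commutator_space_def by (rule metab.subspace_span)

lemma bracket_in_commutator: "a \<in> S \<Longrightarrow> b \<in> S \<Longrightarrow> metab_bracket a b \<in> metab_commutator S"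
  unfolding commutator_space_def by (rule metab.span_base) auto

lemma commutator_mono: "S \<subseteq> T \<Longrightarrow> metab_commutator S \<subseteq> metab_commutator T"
  unfolding commutator_space_def by (rule metab.span_mono) auto

lemma metab_metabelian:
  assumes "a \<in> metab_derived" "b \<in> metab_derived"
  shows "metab_bracket a b = 0"
proof -
  have *: "metab_bracket (metab_bracket p q) (metab_bracket r s) = 0"
    for p q r s :: "('x, 'k::field) free_metab"
    by transfer (simp add: metab_rel_def lie_bracket_in_derived2 lie_bracket_in_derived)
  have **: "metab_bracket (metab_bracket p q) b = 0" for p q
    using assms(2) unfolding commutator_space_def
    by (induction rule: metab.span_induct_alt)
       (auto simp: metab_ad_left.zero metab_bracket_bilinear *)
  show ?thesis
    using assms(1) unfolding commutator_space_def
    by (induction rule: metab.span_induct_alt)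
       (auto simp: metab_ad.zero metab_bracket_bilinear **)
qed

text \<open>In the Jacobi identity for \<open>w\<close>, \<open>a\<close>, \<open>b\<close> the term
  with \<open>[a,b]\<close> is a bracket of two commutators and vanishes. Adjoint operators thus
  commute on the commutator ideal, which is why a polynomial ring can act there.\<close>

lemma metab_bracket_swap:
  assumes "w \<in> metab_derived"
  shows "metab_bracket (metab_bracket w a) b = metab_bracket (metab_bracket w b) a"
proof -
  have "metab_bracket (metab_bracket a b) w = 0"
    using assms by (intro metab_metabelian bracket_in_commutator) auto
  moreover have "metab_bracket (metab_bracket b w) a = - metab_bracket (metab_bracket w b) a"
    by (subst metab_bracket_anticomm[of b w]) (simp add: metab_ad.neg)
  ultimately show ?thesis using metab_bracket_jacobi[of w a b] by simp
qed

lemma monom_induct [case_names zero add_var]: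
  fixes m :: "'x \<Rightarrow>\<^sub>0 nat"
  assumes "P 0" and step: "\<And>m x. P m \<Longrightarrow> P (m + Poly_Mapping.single x 1)"
  shows "P m"
proof (induction m rule: update_induct)
  case (update f a b)
  have "Poly_Mapping.update a b f = f + Poly_Mapping.single a b"
    using update(1) by (intro poly_mapping_eqI)
      (auto simp: lookup_update lookup_add lookup_single when_def in_keys_iff)
  moreover have "P (f + Poly_Mapping.single a n)" for n
  proof (induction n)
    case (Suc n)
    then show ?case using step[of "f + Poly_Mapping.single a n" a]
      by (simp add: add.assoc flip: single_add)
  qed (use update in simp)
  ultimately show ?case by simp
qed (rule assms(1))

lemma pol_monom_0 [simp]: "pol_monom 0 = 1"
  by (simp add: pol_monom_def)

lemma pol_monom_add: "pol_monom (m + m') = pol_monom m * pol_monom m'"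
  by (simp add: pol_monom_def mult_single)

lemma pol_monom_add_var: "pol_monom (m + Poly_Mapping.single x 1) = pol_monom m * pol_var x"
  by (simp add: pol_var_def pol_monom_add)

text \<open>Variables of exponent 0 contribute the identity. Folding over all variables makes the
  list independent of \<open>m\<close>, so that different monomials can be compared along the same
  list.\<close>

lemma monom_act_altdef:
  fixes u :: "('x::{finite,linorder}, 'k::field) free_metab"
  shows "monom_act u m = fold (\<lambda>x. (\<lambda>w. metab_bracket w (metab_gen x)) ^^ Poly_Mapping.lookup m x)
    (sorted_list_of_set UNIV) u"
proof -
  let ?f = "\<lambda>x. (\<lambda>w :: ('x, 'k) free_metab. metab_bracket w (metab_gen x)) ^^ Poly_Mapping.lookup m x"
  have *: "fold ?f (filter (\<lambda>x. x \<in> Poly_Mapping.keys m) xs) u = fold ?f xs u" for xs u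
    by (induction xs arbitrary: u) (auto simp: in_keys_iff)
  have "sorted_list_of_set (Poly_Mapping.keys m)
      = filter (\<lambda>x. x \<in> Poly_Mapping.keys m) (sorted_list_of_set UNIV)"
    by (intro sorted_distinct_set_unique) (auto intro: sorted_wrt_filter)
  then show ?thesis by (simp add: monom_act_def *)
qed

lemma metab_derived_bracket: "metab_bracket a b \<in> metab_derived"
  by (rule bracket_in_commutator) auto

lemma funpow_ad_in_derived:
  "w \<in> metab_derived \<Longrightarrow> ((\<lambda>w. metab_bracket w a) ^^ n) w \<in> metab_derived"
  by (cases n) (auto simp: metab_derived_bracket)

lemma funpow_ad_swap:
  "w \<in> metab_derived \<Longrightarrow>
    ((\<lambda>w. metab_bracket w a) ^^ n) (metab_bracket w b)
      = metab_bracket (((\<lambda>w. metab_bracket w a) ^^ n) w) b"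
  by (induction n) (simp_all add: metab_bracket_swap funpow_ad_in_derived)

lemma monom_act_0 [simp]: "monom_act u 0 = u"
  by (simp add: monom_act_def)

lemma monom_act_in_derived:
  fixes w :: "('x::{finite,linorder}, 'k::field) free_metab"
  assumes "w \<in> metab_derived"
  shows "monom_act w m \<in> metab_derived"
proof -
  have "fold (\<lambda>x. (\<lambda>w. metab_bracket w (metab_gen x)) ^^ Poly_Mapping.lookup m x) xs w
    \<in> metab_derived" for xs
    using assms by (induction xs arbitrary: w) (auto intro!: funpow_ad_in_derived)
  then show ?thesis by (simp add: monom_act_def)
qed

text \<open>The additional operator arises at the position of \<open>x\<close> in the list and moves
  to the outside because adjoint operators commute on the commutator ideal.\<close>

lemma monom_act_add_var:
  fixes w :: "('x::{finite,linorder}, 'k::field) free_metab"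
  assumes "w \<in> metab_derived"
  shows "monom_act w (m + Poly_Mapping.single x 1) = metab_bracket (monom_act w m) (metab_gen x)"
proof -
  define m' where "m' = m + Poly_Mapping.single x 1"
  define f where "f = (\<lambda>m x. (\<lambda>w :: ('x, 'k) free_metab. metab_bracket w (metab_gen x))
    ^^ Poly_Mapping.lookup m x)"
  have f_derived: "f m y w \<in> metab_derived" if "w \<in> metab_derived" for w m y
    using that unfolding f_def by (rule funpow_ad_in_derived)
  have *: "fold (f m) xs (metab_bracket w b) = metab_bracket (fold (f m) xs w) b"
    if "w \<in> metab_derived" for w b xs
    using that
  proof (induction xs arbitrary: w)
    case (Cons y xs)
    then have "f m y (metab_bracket w b) = metab_bracket (f m y w) b"
      unfolding f_def by (intro funpow_ad_swap)
    then show ?case using Cons f_derived by simp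
  qed simp
  have other: "fold (f m') xs w = fold (f m) xs w" if "x \<notin> set xs" for xs w
    using that
    by (intro fold_cong) (auto simp: f_def m'_def lookup_add lookup_single when_def)
  have fx: "f m' x w = metab_bracket (f m x w) (metab_gen x)" for w
    by (simp add: f_def m'_def lookup_add)
  have fy: "f m' y w = f m y w" if "y \<noteq> x" for w y
    using that by (simp add: f_def m'_def lookup_add lookup_single)
  \<comment> \<open>Distinctness ensures that \<open>x\<close> contributes its additional operator
    exactly once; after its position the folds for \<open>m\<close> and \<open>m'\<close>
    agree.\<close>
  have "fold (f m') xs w = metab_bracket (fold (f m) xs w) (metab_gen x)"
    if "w \<in> metab_derived" "distinct xs" "x \<in> set xs" for xs w
    using that
  proof (induction xs arbitrary: w)
    case (Cons y xs)
    show ?case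
    proof (cases "y = x")
      case True
      then show ?thesis using Cons.prems by (simp add: other fx * f_derived)
    next
      case False
      then show ?thesis using Cons by (simp add: fy f_derived)
    qed
  qed simp
  from this[OF assms, of "sorted_list_of_set UNIV"] show ?thesis
    by (simp add: monom_act_altdef f_def m'_def)
qed

lemma monom_act_add:
  fixes w :: "('x::{finite,linorder}, 'k::field) free_metab"
  assumes "w \<in> metab_derived"
  shows "monom_act w (m + m') = monom_act (monom_act w m) m'"
proof (induction m' rule: monom_induct)
  case (add_var m' x)
  have "monom_act w (m + (m' + Poly_Mapping.single x 1)) = metab_bracket (monom_act w (m + m')) (metab_gen x)"
    using monom_act_add_var[OF assms, of "m + m'" x] by (simp add: add.assoc)
  then show ?case
    using add_var monom_act_add_var[OF monom_act_in_derived[OF assms]] by simp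
qed simp

lemma linear_monom_act:
  "Vector_Spaces.linear metab_scale metab_scale
    (\<lambda>u :: ('x::linorder, 'k::field) free_metab. monom_act u m)"
proof -
  have pow: "((\<lambda>w :: ('x, 'k) free_metab. metab_bracket w a) ^^ n) (u + v)
      = ((\<lambda>w. metab_bracket w a) ^^ n) u + ((\<lambda>w. metab_bracket w a) ^^ n) v"
    "((\<lambda>w :: ('x, 'k) free_metab. metab_bracket w a) ^^ n) (metab_scale c u)
      = metab_scale c (((\<lambda>w. metab_bracket w a) ^^ n) u)" for a n u v c
    by (induction n) (simp_all add: metab_bracket_bilinear)
  let ?F = "\<lambda>xs u. fold (\<lambda>x. (\<lambda>w :: ('x, 'k) free_metab. metab_bracket w (metab_gen x))
    ^^ Poly_Mapping.lookup m x) xs u"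
  have "?F xs (u + v) = ?F xs u + ?F xs v"
    "?F xs (metab_scale c u) = metab_scale c (?F xs u)" for xs u v c
    by (induction xs arbitrary: u v) (simp_all add: pow)
  then show ?thesis
    by (simp add: Vector_Spaces.linear_iff metab.vector_space_axioms monom_act_def)
qed

lemma pol_act_eq_lin_ext: "pol_act u = lin_ext metab_scale (monom_act u)"
  by (simp add: fun_eq_iff pol_act_def lin_ext_def)

lemma linear_pol_act: "Vector_Spaces.linear pm_scale metab_scale (pol_act u)"
  unfolding pol_act_eq_lin_ext by (rule metab.linear_lin_ext)

lemma linear_pol_act_left:
  fixes f :: "('x::linorder, 'k::field) pol"
  shows "Vector_Spaces.linear metab_scale metab_scale (\<lambda>u. pol_act u f)"
proof -
  interpret m: Vector_Spaces.linear metab_scale metab_scale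
    "\<lambda>u :: ('x, 'k) free_metab. monom_act u m" for m
    by (rule linear_monom_act)
  show ?thesis
    by (simp add: Vector_Spaces.linear_iff metab.vector_space_axioms pol_act_def m.add m.scale
        metab.scale_right_distrib metab.scale_sum_right sum.distrib mult.commute)
qed

interpretation pol_act: Vector_Spaces.linear pm_scale metab_scale "pol_act u"
  for u :: "('x::linorder, 'k::field) free_metab"
  by (rule linear_pol_act)

interpretation pol_act_left: Vector_Spaces.linear metab_scale metab_scale "\<lambda>u. pol_act u f"
  for f :: "('x::linorder, 'k::field) pol"
  by (rule linear_pol_act_left)

lemma pol_act_monom: "pol_act u (pol_monom m) = monom_act u m"
  by (simp add: pol_act_eq_lin_ext pol_monom_def)

lemma pol_act_1 [simp]: "pol_act u 1 = u"
  using pol_act_monom[of u 0] by simp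

lemma linear_mult_left: "Vector_Spaces.linear pm_scale pm_scale (\<lambda>f. f * g)"
  for g :: "'a::comm_monoid_add \<Rightarrow>\<^sub>0 'k::field"
  by (simp add: Vector_Spaces.linear_iff pm.vector_space_axioms pm_scale_mult distrib_right)

lemma linear_mult_right: "Vector_Spaces.linear pm_scale pm_scale (\<lambda>f. g * f)"
  for g :: "'a::comm_monoid_add \<Rightarrow>\<^sub>0 'k::field"
  by (simp add: Vector_Spaces.linear_iff pm.vector_space_axioms pm_scale_mult distrib_left)

lemmas linear_compose_fun = Vector_Spaces.linear_compose[unfolded o_def]

lemma pol_linear_eqI:
  fixes f :: "('x, 'k::field) pol"
  assumes "vector_space s" "Vector_Spaces.linear pm_scale s F" "Vector_Spaces.linear pm_scale s G"
    and "\<And>m. m \<in> Poly_Mapping.keys f \<Longrightarrow> F (pol_monom m) = G (pol_monom m)"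
  shows "F f = G f"
  using vector_space.linear_eq_on_keys[OF assms(1-3)] assms(4) by (simp add: pol_monom_def)

lemma pol_act_in_derived:
  fixes w :: "('x::{finite,linorder}, 'k::field) free_metab"
  shows "w \<in> metab_derived \<Longrightarrow> pol_act w f \<in> metab_derived"
  unfolding pol_act_def
  by (intro metab.subspace_sum metab.subspace_scale subspace_commutator monom_act_in_derived)

text \<open>Associativity of the module action. Both sides are linear in \<open>f\<close> and in
  \<open>g\<close>, which reduces it to monomials.\<close>

lemma pol_act_mult:
  fixes w :: "('x::{finite,linorder}, 'k::field) free_metab"
  assumes "w \<in> metab_derived"
  shows "pol_act w (f * g) = pol_act (pol_act w f) g"
proof (rule pol_linear_eqI[where f = f and s = metab_scale])
  fix m
  show "pol_act w (pol_monom m * g) = pol_act (pol_act w (pol_monom m)) g"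
  proof (rule pol_linear_eqI[where f = g and s = metab_scale])
    fix m'
    show "pol_act w (pol_monom m * pol_monom m') = pol_act (pol_act w (pol_monom m)) (pol_monom m')"
      using assms by (simp add: pol_act_monom monom_act_add flip: pol_monom_add)
  qed (intro metab.vector_space_axioms linear_compose_fun[OF linear_mult_right linear_pol_act]
      linear_pol_act)+
qed (intro metab.vector_space_axioms linear_compose_fun[OF linear_mult_left linear_pol_act]
    linear_compose_fun[OF linear_pol_act linear_pol_act_left])+

lemma pol_act_var:
  fixes w :: "('x::{finite,linorder}, 'k::field) free_metab"
  assumes "w \<in> metab_derived"
  shows "pol_act w (pol_var x) = metab_bracket w (metab_gen x)"
  using monom_act_add_var[OF assms, of 0 x] by (simp add: pol_var_def pol_act_monom)

lemma pol_act_monom_add_var: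
  fixes w :: "('x::{finite,linorder}, 'k::field) free_metab"
  assumes "w \<in> metab_derived"
  shows "pol_act w (pol_monom (m + Poly_Mapping.single x 1))
    = metab_bracket (pol_act w (pol_monom m)) (metab_gen x)"
  using assms by (simp only: pol_act_monom monom_act_add_var)

lemma pol_act_linear:
  fixes w :: "('x::{finite,linorder}, 'k::field) free_metab"
  assumes "w \<in> metab_derived"
  shows "pol_act w (pol_linear v) = metab_bracket w (metab_linear v)"
  by (simp add: pol_linear_def metab_linear_def pol_act.sum pol_act.scale metab_ad_left.sum
      metab_ad_left.scale pol_act_var assms)


section \<open>The maps \<open>\<pi>\<^sub>a\<close>\<close>

text \<open>On the commutator ideal, bracketing with a variable is multiplication by it, so this is
  commutativity of the polynomial ring.\<close>

lemma pol_act_bracket: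
  fixes w :: "('x::{finite,linorder}, 'k::field) free_metab"
  assumes "w \<in> metab_derived"
  shows "metab_bracket (pol_act w f) (metab_gen x) = pol_act (metab_bracket w (metab_gen x)) f"
proof -
  have "metab_bracket (pol_act w f) (metab_gen x) = pol_act w (f * pol_var x)"
    using assms by (simp add: pol_act_mult pol_act_var pol_act_in_derived)
  also have "\<dots> = pol_act w (pol_var x * f)" by (simp add: mult.commute)
  also have "\<dots> = pol_act (metab_bracket w (metab_gen x)) f"
    using assms by (simp add: pol_act_mult pol_act_var)
  finally show ?thesis .
qed

lemma pi_map_eq_lin_ext: "pi_map z = lin_ext metab_scale (pi_monom z)"
  by (simp add: fun_eq_iff pi_map_def lin_ext_def)

lemma linear_pi_map: "Vector_Spaces.linear pm_scale metab_scale (pi_map z)"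
  unfolding pi_map_eq_lin_ext by (rule metab.linear_lin_ext)

interpretation pi_map: Vector_Spaces.linear pm_scale metab_scale "pi_map z" for z
  by (rule linear_pi_map)

lemma pi_map_monom: "pi_map z (pol_monom m) = pi_monom z m"
  by (simp add: pi_map_eq_lin_ext pol_monom_def)

lemma pi_monom_altdef:
  fixes z :: "'x::{finite,linorder}"
  shows "pi_monom z m = (\<Sum>x\<in>UNIV. metab_scale (of_nat (Poly_Mapping.lookup m x))
      (pol_act (metab_bracket (metab_gen z) (metab_gen x)) (pol_monom (m - Poly_Mapping.single x 1))))"
  unfolding pi_monom_def by (intro sum.mono_neutral_left) (auto simp: in_keys_iff)

text \<open>The sum defining \<open>\<pi>\<close> is a formal differential with \<open>[z,x]\<close>
  in the place of \<open>dx\<close>, hence obeys the Leibniz rule: the removed factor comes either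
  from \<open>m\<close> or from \<open>m'\<close>.\<close>

lemma pi_monom_add:
  fixes z :: "'x::{finite,linorder}"
  shows "pi_monom z (m + m')
    = pol_act (pi_monom z m) (pol_monom m') + pol_act (pi_monom z m') (pol_monom m)"
proof -
  let ?c = "\<lambda>x. metab_bracket (metab_gen z) (metab_gen x)"
  \<comment> \<open>Subtraction of exponents is truncated; where it would truncate, the coefficient
    \<open>lookup m x\<close> is zero.\<close>
  have *: "metab_scale (of_nat (Poly_Mapping.lookup m x))
        (pol_act (?c x) (pol_monom (m + m' - Poly_Mapping.single x 1)))
      = metab_scale (of_nat (Poly_Mapping.lookup m x))
          (pol_act (pol_act (?c x) (pol_monom (m - Poly_Mapping.single x 1))) (pol_monom m'))" for m m' x
  proof (cases "Poly_Mapping.lookup m x = 0")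
    case False
    then have "m + m' - Poly_Mapping.single x 1 = m - Poly_Mapping.single x 1 + m'"
      by (intro poly_mapping_eqI) (auto simp: lookup_add lookup_minus lookup_single when_def)
    then show ?thesis by (simp add: pol_monom_add pol_act_mult metab_derived_bracket)
  qed simp
  have "pi_monom z (m + m')
      = (\<Sum>x\<in>UNIV. metab_scale (of_nat (Poly_Mapping.lookup m x))
        (pol_act (?c x) (pol_monom (m + m' - Poly_Mapping.single x 1))))
      + (\<Sum>x\<in>UNIV. metab_scale (of_nat (Poly_Mapping.lookup m' x))
        (pol_act (?c x) (pol_monom (m' + m - Poly_Mapping.single x 1))))"
    by (simp add: pi_monom_altdef lookup_add metab.scale_left_distrib sum.distrib add.commute)
  then show ?thesis
    unfolding * by (simp add: pi_monom_altdef pol_act_left.sum pol_act_left.scale)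
qed

text \<open>So \<pi> is a derivation from the polynomial ring into the commutator ideal viewed as a
  module, determined by its values \<open>[z,x]\<close> on the variables.\<close>

lemma pi_map_mult:
  fixes z :: "'x::{finite,linorder}"
  shows "pi_map z (f * g) = pol_act (pi_map z f) g + pol_act (pi_map z g) f"
proof (rule pol_linear_eqI[where f = f and s = metab_scale])
  fix m
  show "pi_map z (pol_monom m * g) = pol_act (pi_map z (pol_monom m)) g + pol_act (pi_map z g) (pol_monom m)"
    by (rule pol_linear_eqI[where f = g and s = metab_scale])
      (simp_all add: pi_map_monom pi_monom_add Vector_Spaces.linear_iff pm.vector_space_axioms
        metab.vector_space_axioms distrib_left pm_scale_mult pi_map.add pi_map.scale pol_act.add
        pol_act.scale pol_act_left.add pol_act_left.scale metab.scale_right_distrib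
        flip: pol_monom_add)
qed (simp_all add: Vector_Spaces.linear_iff pm.vector_space_axioms
        metab.vector_space_axioms distrib_right pm_scale_mult pi_map.add pi_map.scale pol_act.add
        pol_act.scale pol_act_left.add pol_act_left.scale metab.scale_right_distrib)

lemma pi_map_var: "pi_map z (pol_var x) = metab_bracket (metab_gen z) (metab_gen x)"
  by (simp add: pol_var_def pi_map_monom pi_monom_def)

lemma pi_map_1 [simp]: "pi_map z 1 = 0"
  using pi_map_monom[of z 0] by (simp add: pi_monom_def)

lemma pi_map_in_derived:
  fixes z :: "'x::{finite,linorder}"
  shows "pi_map z f \<in> metab_derived"
  unfolding pi_map_def pi_monom_def
  by (intro metab.subspace_sum metab.subspace_scale subspace_commutator pol_act_in_derived
      metab_derived_bracket)

lemma pi_map_linear: "pi_map z (pol_linear v) = metab_bracket (metab_gen z) (metab_linear v)"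
  by (simp add: pol_linear_def metab_linear_def pi_map.sum pi_map.scale metab_ad_left.sum
      metab_ad_left.scale pi_map_var)

lemma pi_map_monom_add_var:
  fixes z :: "'x::{finite,linorder}"
  shows "pi_map z (pol_monom (m + Poly_Mapping.single x 1)) =
    metab_bracket (pi_map z (pol_monom m)) (metab_gen x) +
    pol_act (metab_bracket (metab_gen z) (metab_gen x)) (pol_monom m)"
  by (simp only: pol_monom_add_var pi_map_mult pi_map_var pol_act_var[OF pi_map_in_derived])

section \<open>Degree of monomials and the exchange identity between \<open>\<pi>\<^sub>a\<close>
  and \<open>\<pi>\<^sub>b\<close>\<close>

definition monom_deg :: "('x::finite \<Rightarrow>\<^sub>0 nat) \<Rightarrow> nat"
  where "monom_deg m = (\<Sum>x\<in>UNIV. Poly_Mapping.lookup m x)"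

lemma monom_deg_0 [simp]: "monom_deg 0 = 0"
  by (simp add: monom_deg_def)

lemma monom_deg_add_var: "monom_deg (m + Poly_Mapping.single x 1) = Suc (monom_deg m)"
  by (simp add: monom_deg_def lookup_add sum.distrib lookup_single when_def)

lemma monom_deg_eq_0_iff: "monom_deg m = 0 \<longleftrightarrow> m = 0"
  by (auto simp: monom_deg_def intro: poly_mapping_eqI)

lemma metab_jacobi_diff:
  "metab_bracket (metab_bracket a x) b - metab_bracket (metab_bracket b x) a
    = metab_bracket (metab_bracket a b) x"
proof -
  have "metab_bracket (metab_bracket x a) b = - metab_bracket (metab_bracket a x) b"
    by (subst metab_bracket_anticomm[of x a]) (simp add: metab_ad.neg)
  then show ?thesis using metab_bracket_jacobi[of a b x] by (simp add: algebra_simps)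
qed

text \<open>Induction on the degree: by the Leibniz rule, a new factor \<open>x\<close> multiplies
  the old difference by \<open>x\<close> and adds \<open>([a,x]b - [b,x]a) m\<close>. The Jacobi
  identity turns the latter into \<open>[a,b] x m\<close>, which raises the coefficient by
  one.\<close>

lemma pi_map_swap:
  fixes a b :: "'x::{finite,linorder}"
  shows "metab_bracket (pi_map a (pol_monom m)) (metab_gen b)
      - metab_bracket (pi_map b (pol_monom m)) (metab_gen a)
    = metab_scale (of_nat (monom_deg m) :: 'k::field)
        (pol_act (metab_bracket (metab_gen a) (metab_gen b)) (pol_monom m))"
proof (induction m rule: monom_induct)
  case zero
  then show ?case by (simp add: metab_ad.zero)
next
  case (add_var m x)
  let ?g = "metab_gen :: 'x \<Rightarrow> ('x, 'k) free_metab"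
  let ?c = "metab_bracket (?g a) (?g b)"
  \<comment> \<open>Leibniz rule followed by commuting operators: \<open>x\<close> goes outside in
    the first term and \<open>m\<close> goes outside in the second.\<close>
  have split: "metab_bracket (pi_map p (pol_monom (m + Poly_Mapping.single x 1))) (?g q)
      = metab_bracket (metab_bracket (pi_map p (pol_monom m)) (?g q)) (?g x)
        + pol_act (metab_bracket (metab_bracket (?g p) (?g x)) (?g q)) (pol_monom m)" for p q
    unfolding pi_map_monom_add_var metab_ad.add
    by (simp add: pol_act_bracket metab_derived_bracket
        metab_bracket_swap[OF pi_map_in_derived, of _ _ "?g x"])
  have "metab_bracket (pi_map a (pol_monom (m + Poly_Mapping.single x 1))) (?g b)
        - metab_bracket (pi_map b (pol_monom (m + Poly_Mapping.single x 1))) (?g a)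
      = metab_bracket (metab_bracket (pi_map a (pol_monom m)) (?g b)
            - metab_bracket (pi_map b (pol_monom m)) (?g a)) (?g x)
        + pol_act (metab_bracket (metab_bracket (?g a) (?g x)) (?g b)
            - metab_bracket (metab_bracket (?g b) (?g x)) (?g a)) (pol_monom m)"
    unfolding split metab_ad.diff pol_act_left.diff by (simp add: algebra_simps)
  also have "\<dots> = metab_scale (of_nat (monom_deg m)) (metab_bracket (pol_act ?c (pol_monom m)) (?g x))
      + pol_act (metab_bracket ?c (?g x)) (pol_monom m)"
    unfolding add_var metab_jacobi_diff by (simp add: metab_ad.scale)
  also have "\<dots> = metab_scale (of_nat (Suc (monom_deg m)))
      (metab_bracket (pol_act ?c (pol_monom m)) (?g x))"
    by (simp add: pol_act_bracket metab_derived_bracket metab.scale_left_distrib add.commute)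
  finally show ?case
    by (simp only: monom_deg_add_var pol_act_monom_add_var[OF metab_derived_bracket])
qed

section \<open>Derivations of both algebras with the same linear values on the generators\<close>

locale linear_derivations =
  fixes DP :: "('x::{finite,linorder}, 'k::field) pol \<Rightarrow> ('x, 'k) pol"
    and DL :: "('x, 'k) free_metab \<Rightarrow> ('x, 'k) free_metab"
    and d :: "'x \<Rightarrow> ('x \<Rightarrow>\<^sub>0 'k)"
  assumes DP: "derivation pm_scale (*) DP" and DP_var: "DP (pol_var x) = pol_linear (d x)"
    and DL: "derivation metab_scale metab_bracket DL" and DL_gen: "DL (metab_gen x) = metab_linear (d x)"
begin

sublocale DP: Vector_Spaces.linear pm_scale pm_scale DP
  using DP by (simp add: derivation_def)

sublocale DL: Vector_Spaces.linear metab_scale metab_scale DL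
  using DL by (simp add: derivation_def)

lemma DP_mult: "DP (f * g) = DP f * g + f * DP g"
  using DP by (simp add: derivation_def)

lemma DL_bracket: "DL (metab_bracket a b) = metab_bracket (DL a) b + metab_bracket a (DL b)"
  using DL by (simp add: derivation_def)

lemma DP_1 [simp]: "DP 1 = 0"
  using DP_mult[of 1 1] by (metis add_cancel_right_right mult.left_neutral mult.right_neutral)

lemma DL_commutator:
  assumes S: "\<And>a. a \<in> S \<Longrightarrow> DL a \<in> S" and w: "w \<in> metab_commutator S"
  shows "DL w \<in> metab_commutator S"
  using w unfolding commutator_space_def
proof (induction rule: metab.span_induct_alt)
  case base
  then show ?case by (simp add: DL.zero metab.span_zero)
next
  case (step c p q)
  then obtain a b where "p = metab_bracket a b" "a \<in> S" "b \<in> S" by blast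
  then have "DL p \<in> metab_commutator S"
    using S by (auto simp: DL_bracket intro!: metab.subspace_add subspace_commutator bracket_in_commutator)
  then show ?case
    using step(2) by (simp add: DL.add DL.scale metab.span_add metab.span_scale commutator_space_def)
qed

lemma DL_derived: "w \<in> metab_derived \<Longrightarrow> DL w \<in> metab_derived"
  by (rule DL_commutator) auto

text \<open>Leibniz rule for the action. It holds because both derivations send \<open>x\<close> to
  the same linear form, and bracketing with that form in the Lie algebra is the action of that form
  as a polynomial.\<close>

lemma DL_pol_act:
  assumes w: "w \<in> metab_derived"
  shows "DL (pol_act w f) = pol_act (DL w) f + pol_act w (DP f)"
proof (rule pol_linear_eqI[where f = f and s = metab_scale])
  fix m
  show "DL (pol_act w (pol_monom m)) = pol_act (DL w) (pol_monom m) + pol_act w (DP (pol_monom m))"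
  proof (induction m rule: monom_induct)
    case (add_var m x)
    let ?f = "pol_monom m :: ('x, 'k) pol"
    have "DL (pol_act w (?f * pol_var x))
        = metab_bracket (DL (pol_act w ?f)) (metab_gen x) + metab_bracket (pol_act w ?f) (metab_linear (d x))"
      by (simp add: pol_act_mult w pol_act_var pol_act_in_derived DL_bracket DL_gen)
    also have "\<dots> = pol_act (DL w) (?f * pol_var x) + pol_act w (DP ?f * pol_var x)
        + pol_act w (?f * DP (pol_var x))"
      unfolding add_var
      by (simp add: pol_act_mult w pol_act_var pol_act_in_derived DL_derived DP_var pol_act_linear
          metab_ad.add)
    finally show ?case unfolding pol_monom_add_var DP_mult pol_act.add by (simp add: add.assoc)
  qed simp
qed (simp_all add: Vector_Spaces.linear_iff pm.vector_space_axioms metab.vector_space_axioms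
    DL.add DL.scale DP.add DP.scale pol_act.add pol_act.scale metab.scale_right_distrib)

text \<open>Commutation propagates along products by the Leibniz rules. On a variable it reads
  \<open>\<delta>[z,x] = [z, \<delta>(x)]\<close>, and here \<delta>(z) = 0 enters.\<close>

lemma DL_pi_map:
  assumes "d z = 0"
  shows "DL (pi_map z f) = pi_map z (DP f)"
proof (rule pol_linear_eqI[where f = f and s = metab_scale])
  fix m
  show "DL (pi_map z (pol_monom m)) = pi_map z (DP (pol_monom m))"
  proof (induction m rule: monom_induct)
    case zero
    then show ?case by (simp add: DL.zero pi_map.zero)
  next
    case (add_var m x)
    let ?f = "pol_monom m :: ('x, 'k) pol"
    have "DL (metab_gen z) = 0" by (simp add: DL_gen assms metab_linear_def)
    then have "DL (metab_bracket (metab_gen z) (metab_gen x)) = pi_map z (DP (pol_var x))"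
      by (simp add: DL_bracket metab_ad.zero DL_gen DP_var pi_map_linear)
    then have "DL (pi_map z (?f * pol_var x)) = pi_map z (DP (?f * pol_var x))"
      by (simp add: pi_map_mult DP_mult pi_map.add DL.add DL_pol_act pi_map_in_derived pi_map_var
          metab_derived_bracket add_var algebra_simps)
    then show ?case by (simp only: pol_monom_add_var)
  qed
qed (simp_all add: Vector_Spaces.linear_iff pm.vector_space_axioms metab.vector_space_axioms
    DL.add DL.scale DP.add DP.scale pi_map.add pi_map.scale)

end


section \<open>Generators of commutator ideals\<close>

lemma metab_subalg_closed:
  fixes Y :: "'x set"
  shows "metab.subspace (metab_subalg Y :: ('x, 'k::field) free_metab set) \<and>
    (\<forall>a\<in>metab_subalg Y. \<forall>b\<in>metab_subalg Y.
    metab_bracket a b \<in> (metab_subalg Y :: ('x, 'k) free_metab set))"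
proof -
  define P where "P = (\<lambda>S :: ('x, 'k) free_metab set. metab.subspace S \<and>
    (\<forall>a\<in>S. \<forall>b\<in>S. metab_bracket a b \<in> S))"
  have "P (P hull (metab_gen ` Y))"
    by (rule hull_in) (auto simp: P_def intro!: metab.subspace_Inter)
  then show ?thesis by (simp add: P_def metab_subalg_def generated_subalgebra_def)
qed

lemma subspace_metab_subalg: "metab.subspace (metab_subalg Y)"
  and bracket_in_metab_subalg:
    "a \<in> metab_subalg Y \<Longrightarrow> b \<in> metab_subalg Y \<Longrightarrow> metab_bracket a b \<in> metab_subalg Y"
  using metab_subalg_closed by auto

lemma gen_in_metab_subalg: "x \<in> Y \<Longrightarrow> metab_gen x \<in> metab_subalg Y"
  unfolding metab_subalg_def generated_subalgebra_def by (rule hull_inc) auto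

lemma metab_subalg_minimal:
  assumes "metab.subspace T" "\<And>a b. a \<in> T \<Longrightarrow> b \<in> T \<Longrightarrow> metab_bracket a b \<in> T"
    and "\<And>x. x \<in> Y \<Longrightarrow> metab_gen x \<in> T"
  shows "metab_subalg Y \<subseteq> T"
  unfolding metab_subalg_def generated_subalgebra_def using assms by (intro hull_minimal) auto

text \<open>A spanning set of the commutator ideal of the subalgebra generated by \<open>Y\<close>.
  In general it is not a basis, because antisymmetry and the Jacobi identity impose
  relations.\<close>

definition poly_commutators :: "'x::linorder set \<Rightarrow> ('x, 'k::field) free_metab set"
  where "poly_commutators Y = {pol_act (metab_bracket (metab_gen a) (metab_gen b)) (pol_monom m) | a b m.
    a \<in> Y \<and> b \<in> Y \<and> Poly_Mapping.keys m \<subseteq> Y}"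

lemma keys_add_nat: "Poly_Mapping.keys (m + m') = Poly_Mapping.keys m \<union> Poly_Mapping.keys m'"
  for m m' :: "'x \<Rightarrow>\<^sub>0 nat"
  by (auto simp: in_keys_iff lookup_add)

lemma bracket_in_span:
  assumes "\<And>p q. p \<in> G \<Longrightarrow> q \<in> G \<Longrightarrow> metab_bracket p q \<in> metab.span H"
    and p: "p \<in> metab.span G" and q: "q \<in> metab.span G"
  shows "metab_bracket p q \<in> metab.span H"
proof -
  have *: "metab_bracket p q \<in> metab.span H" if "p \<in> G" for p
    using q
  proof (induction rule: metab.span_induct_alt)
    case (step c x y)
    then show ?case using assms(1)[OF that]
      by (simp add: metab_bracket_bilinear metab.span_add metab.span_scale)
  qed (simp add: metab_ad_left.zero metab.span_zero)
  show ?thesis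
    using p
  proof (induction rule: metab.span_induct_alt)
    case (step c x y)
    then show ?case using *
      by (simp add: metab_bracket_bilinear metab.span_add metab.span_scale)
  qed (simp add: metab_ad.zero metab.span_zero)
qed

lemma bracket_gen_poly_commutator:
  fixes Y :: "'x::{finite,linorder} set"
  assumes "p \<in> poly_commutators Y" "x \<in> Y"
  shows "metab_bracket p (metab_gen x) \<in> poly_commutators Y"
proof -
  obtain a b m where p: "p = pol_act (metab_bracket (metab_gen a) (metab_gen b)) (pol_monom m)"
    "a \<in> Y" "b \<in> Y" "Poly_Mapping.keys m \<subseteq> Y"
    using assms(1) by (auto simp: poly_commutators_def)
  have "metab_bracket p (metab_gen x)
      = pol_act (metab_bracket (metab_gen a) (metab_gen b)) (pol_monom (m + Poly_Mapping.single x 1))"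
    unfolding p(1) by (simp only: pol_act_monom_add_var[OF metab_derived_bracket])
  moreover have "Poly_Mapping.keys (m + Poly_Mapping.single x 1) \<subseteq> Y"
    using p(4) assms(2) by (simp add: keys_add_nat)
  ultimately show ?thesis using p(2,3) unfolding poly_commutators_def by blast
qed

lemma poly_commutators_subset_derived:
  "poly_commutators Y \<subseteq> (metab_derived :: ('x::{finite,linorder}, 'k::field) free_metab set)"
  by (auto simp: poly_commutators_def intro!: pol_act_in_derived metab_derived_bracket)

lemma poly_commutator_in_commutator:
  fixes a :: "'x::{finite,linorder}"
  assumes "a \<in> Y" "b \<in> Y" "Poly_Mapping.keys m \<subseteq> Y"
  shows "pol_act (metab_bracket (metab_gen a) (metab_gen b)) (pol_monom m)
    \<in> (metab_commutator (metab_subalg Y) :: ('x, 'k::field) free_metab set)"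
proof -
  let ?w = "metab_bracket (metab_gen a) (metab_gen b) :: ('x, 'k) free_metab"
  \<comment> \<open>Membership in the subalgebra itself is carried along, since the next bracket
    with a variable must be a bracket of two elements of the subalgebra.\<close>
  have "pol_act ?w (pol_monom m) \<in> metab_subalg Y \<and>
      pol_act ?w (pol_monom m) \<in> metab_commutator (metab_subalg Y)"
    using assms(3)
  proof (induction m rule: monom_induct)
    case zero
    then show ?case
      using assms(1,2) by (simp add: bracket_in_metab_subalg bracket_in_commutator gen_in_metab_subalg)
  next
    case (add_var m x)
    then have "x \<in> Y" "pol_act ?w (pol_monom m) \<in> metab_subalg Y" by (simp_all add: keys_add_nat)
    then show ?case
      unfolding pol_act_monom_add_var[OF metab_derived_bracket]
      by (simp add: bracket_in_metab_subalg bracket_in_commutator gen_in_metab_subalg)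
  qed
  then show ?thesis by simp
qed

text \<open>The generators together with \<open>poly_commutators Y\<close> span a subalgebra, as
  every bracket of two of these elements falls into the span of \<open>poly_commutators Y\<close>:
  variables act by enlarging the monomial, and two commutators bracket to zero.\<close>

lemma commutator_metab_subalg:
  fixes Y :: "'x::{finite,linorder} set"
  shows "metab_commutator (metab_subalg Y) = (metab.span (poly_commutators Y) :: ('x, 'k::field) free_metab set)"
proof
  let ?G = "metab_gen ` Y \<union> poly_commutators Y :: ('x, 'k) free_metab set"
  have G: "metab_bracket p q \<in> metab.span (poly_commutators Y)" if "p \<in> ?G" "q \<in> ?G" for p q
  proof -
    consider a b where "p = metab_gen a" "q = metab_gen b" "a \<in> Y" "b \<in> Y"
      | a where "p = metab_gen a" "a \<in> Y" "q \<in> poly_commutators Y"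
      | b where "q = metab_gen b" "b \<in> Y" "p \<in> poly_commutators Y"
      | "p \<in> poly_commutators Y" "q \<in> poly_commutators Y"
      using \<open>p \<in> ?G\<close> \<open>q \<in> ?G\<close> by blast
    then show ?thesis
    proof cases
      case 1
      have "pol_act (metab_bracket p q) (pol_monom 0) \<in> poly_commutators Y"
        using 1 unfolding poly_commutators_def by fastforce
      then show ?thesis by (simp add: metab.span_base)
    next
      case 2
      then show ?thesis
        unfolding metab_bracket_anticomm[of p q]
        by (simp add: metab.span_neg metab.span_base bracket_gen_poly_commutator)
    next
      case 3
      then show ?thesis by (simp add: metab.span_base bracket_gen_poly_commutator)
    next
      case 4
      then have "metab_bracket p q = 0"
        using poly_commutators_subset_derived by (intro metab_metabelian) blast+
      then show ?thesis by (simp add: metab.span_zero)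
    qed
  qed
  have span_G: "metab_bracket p q \<in> metab.span (poly_commutators Y)"
    if "p \<in> metab.span ?G" "q \<in> metab.span ?G" for p q
    using G that by (rule bracket_in_span)
  have mono: "metab.span (poly_commutators Y) \<subseteq> metab.span ?G"
    by (rule metab.span_mono) auto
  have sub: "metab_subalg Y \<subseteq> metab.span ?G"
    using span_G mono
    by (intro metab_subalg_minimal metab.subspace_span) (blast intro: metab.span_base)+
  have "metab_bracket p q \<in> metab.span (poly_commutators Y)"
    if "p \<in> metab_subalg Y" "q \<in> metab_subalg Y" for p q :: "('x, 'k) free_metab"
    using that sub span_G by blast
  then show "metab_commutator (metab_subalg Y) \<subseteq> (metab.span (poly_commutators Y) :: ('x, 'k) free_metab set)"
    unfolding commutator_space_def
    by (intro metab.span_minimal metab.subspace_span) blast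
  show "(metab.span (poly_commutators Y) :: ('x, 'k) free_metab set) \<subseteq> metab_commutator (metab_subalg Y)"
    by (intro metab.span_minimal subspace_commutator)
       (auto simp: poly_commutators_def poly_commutator_in_commutator)
qed

lemma na_mult_single:
  "na_mult (Poly_Mapping.single a c) (Poly_Mapping.single b d) = Poly_Mapping.single (Br a b) (c * d)"
  by (rule poly_mapping_eqI) (auto simp: na_mult.rep_eq lookup_single when_def split: word.split)

text \<open>Every element lifts through both quotients to a linear combination of bracketed words,
  and words lie in the subalgebra by induction.\<close>

lemma metab_subalg_UNIV: "metab_subalg UNIV = (UNIV :: ('x, 'k::field) free_metab set)"
proof -
  define \<kappa> where "\<kappa> = (\<lambda>r. abs_free_metab (abs_free_lie r) :: ('x, 'k) free_metab)"
  have word: "\<kappa> (Poly_Mapping.single w 1) = metab_word w" for w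
  proof (induction w)
    case (Gen x)
    then show ?case by (simp add: \<kappa>_def metab_gen_def lie_gen_def)
  next
    case (Br a b)
    have "na_mult (Poly_Mapping.single a 1) (Poly_Mapping.single b 1)
        = (Poly_Mapping.single (Br a b) 1 :: 'x word \<Rightarrow>\<^sub>0 'k)"
      by (simp add: na_mult_single)
    then have "\<kappa> (Poly_Mapping.single (Br a b) 1)
        = metab_bracket (\<kappa> (Poly_Mapping.single a 1)) (\<kappa> (Poly_Mapping.single b 1))"
      by (simp only: \<kappa>_def metab_bracket.abs_eq lie_bracket.abs_eq)
    then show ?case by (simp only: Br metab_word.simps)
  qed
  have "Vector_Spaces.linear pm_scale metab_scale \<kappa>"
    by (simp add: Vector_Spaces.linear_iff pm.vector_space_axioms metab.vector_space_axioms \<kappa>_def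
        plus_free_metab.abs_eq plus_free_lie.abs_eq metab_scale.abs_eq lie_scale.abs_eq)
  then have \<kappa>: "\<kappa> r = lin_ext metab_scale metab_word r" for r
    by (rule metab.linear_eq_on_keys[OF _ metab.linear_lin_ext]) (simp add: word)
  have "metab_word w \<in> metab_subalg UNIV" for w :: "'x word"
    by (induction w) (simp_all add: gen_in_metab_subalg bracket_in_metab_subalg)
  then have "\<kappa> r \<in> metab_subalg UNIV" for r
    unfolding \<kappa> lin_ext_def by (intro metab.subspace_sum metab.subspace_scale subspace_metab_subalg)
  moreover have "\<exists>r. p = \<kappa> r" for p
    unfolding \<kappa>_def
    by (metis Quotient_abs_rep[OF Quotient_free_metab] Quotient_abs_rep[OF Quotient_free_lie])
  ultimately show ?thesis by (metis UNIV_eq_I)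
qed

lemma metab_derived_eq_span:
  "metab_derived = (metab.span (poly_commutators UNIV) :: ('x::{finite,linorder}, 'k::field) free_metab set)"
  using commutator_metab_subalg[of UNIV] by (simp add: metab_subalg_UNIV)


section \<open>The Magnus embedding\<close>

primrec word_lin :: "'x word \<Rightarrow> ('x, 'k::field) pol" where
  "word_lin (Gen x) = pol_var x"
| "word_lin (Br a b) = 0"

text \<open>Lie analogue of Fox derivatives: the coefficient of the \<open>i\<close>-th basis vector
  under the Magnus map, with \<open>word_lin\<close> as its linear part. It is defined on words
  first and then descends through the two quotients.\<close>

primrec word_fox :: "'x \<Rightarrow> 'x word \<Rightarrow> ('x, 'k::field) pol" where
  "word_fox i (Gen x) = (if x = i then 1 else 0)"
| "word_fox i (Br a b) = word_fox i a * word_lin b - word_fox i b * word_lin a"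

abbreviation na_lin :: "('x word \<Rightarrow>\<^sub>0 'k::field) \<Rightarrow> ('x, 'k) pol"
  where "na_lin \<equiv> lin_ext pm_scale word_lin"

abbreviation na_fox :: "'x \<Rightarrow> ('x word \<Rightarrow>\<^sub>0 'k::field) \<Rightarrow> ('x, 'k) pol"
  where "na_fox i \<equiv> lin_ext pm_scale (word_fox i)"

interpretation na_lin: Vector_Spaces.linear pm_scale pm_scale na_lin
  by (rule pm.linear_lin_ext)

interpretation na_fox: Vector_Spaces.linear pm_scale pm_scale "na_fox i" for i
  by (rule pm.linear_lin_ext)

lemma na_mult_linear_eqI:
  assumes lin: "Vector_Spaces.linear pm_scale pm_scale F"
    and G: "\<And>q. Vector_Spaces.linear pm_scale pm_scale (\<lambda>p. G p q)"
      "\<And>p. Vector_Spaces.linear pm_scale pm_scale (G p)"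
    and eq: "\<And>a b. F (Poly_Mapping.single (Br a b) 1)
      = G (Poly_Mapping.single a 1) (Poly_Mapping.single b 1)"
  shows "F (na_mult p q) = G p q"
proof (rule pm.linear_eq_on_keys[where p = p])
  fix a
  show "F (na_mult (Poly_Mapping.single a 1) q) = G (Poly_Mapping.single a 1) q"
  proof (rule pm.linear_eq_on_keys[where p = q])
    show "Vector_Spaces.linear pm_scale pm_scale (\<lambda>q. F (na_mult (Poly_Mapping.single a 1) q))"
      by (rule linear_compose_fun[OF _ lin])
        (simp add: Vector_Spaces.linear_iff pm.vector_space_axioms na_mult_bilinear)
  qed (simp_all add: na_mult_single eq G)
  show "Vector_Spaces.linear pm_scale pm_scale (\<lambda>p. F (na_mult p q))"
    by (rule linear_compose_fun[OF _ lin])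
      (simp add: Vector_Spaces.linear_iff pm.vector_space_axioms na_mult_bilinear)
qed (rule G)

lemma na_lin_mult [simp]: "na_lin (na_mult p q) = 0"
  by (rule na_mult_linear_eqI) 
    (simp_all add: na_lin.add na_lin.scale Vector_Spaces.linear_iff pm.vector_space_axioms)

lemma na_fox_mult: "na_fox i (na_mult p q) = na_fox i p * na_lin q - na_fox i q * na_lin p"
  by (rule na_mult_linear_eqI[OF pm.linear_lin_ext])
    (simp_all add: Vector_Spaces.linear_iff pm.vector_space_axioms na_fox.add
      na_fox.scale na_lin.add na_lin.scale pm_scale_mult pm.scale_right_diff_distrib algebra_simps)

text \<open>The formula for \<open>na_fox\<close> on products is the bracket of a Lie algebra of
  pairs. Squares vanish by commutativity of polynomials; in the Jacobi sum inner products have no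
  linear part and the remaining six terms cancel.\<close>

lemma lie_ideal_lin_fox:
  assumes "p \<in> lie_ideal"
  shows "na_lin p = 0 \<and> na_fox i p = 0"
  using assms
proof (induction rule: lie_ideal.induct)
  case (jacobi p q r)
  show ?case by (simp add: na_lin.add na_fox.add na_fox_mult algebra_simps)
qed (simp_all add: na_lin.zero na_fox.zero na_lin.add na_fox.add na_lin.scale na_fox.scale na_fox_mult)

lift_definition lie_lin :: "('x, 'k::field) free_lie \<Rightarrow> ('x, 'k) pol" is na_lin
  using lie_ideal_lin_fox unfolding lie_rel_def by (metis na_lin.diff eq_iff_diff_eq_0)

lift_definition lie_fox :: "'x \<Rightarrow> ('x, 'k::field) free_lie \<Rightarrow> ('x, 'k) pol" is na_fox
  using lie_ideal_lin_fox unfolding lie_rel_def by (metis na_fox.diff eq_iff_diff_eq_0)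

interpretation lie_lin: Vector_Spaces.linear lie_scale pm_scale lie_lin
  unfolding Vector_Spaces.linear_iff
  by (intro conjI allI lie.vector_space_axioms pm.vector_space_axioms; transfer)
     (simp_all add: na_lin.add na_lin.scale)

interpretation lie_fox: Vector_Spaces.linear lie_scale pm_scale "lie_fox i" for i
  unfolding Vector_Spaces.linear_iff
  by (intro conjI allI lie.vector_space_axioms pm.vector_space_axioms; transfer)
     (simp_all add: na_fox.add na_fox.scale)

lemma lie_lin_bracket [simp]: "lie_lin (lie_bracket p q) = 0"
  by transfer simp

lemma lie_fox_bracket: "lie_fox i (lie_bracket p q) = lie_fox i p * lie_lin q - lie_fox i q * lie_lin p"
  by transfer (rule na_fox_mult)

lemma lie_lin_derived: "w \<in> lie_derived \<Longrightarrow> lie_lin w = 0"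
  unfolding lie_derived_def commutator_space_def
  by (induction rule: lie.span_induct_alt) (auto simp: lie_lin.zero lie_lin.add lie_lin.scale)

text \<open>Both terms of \<open>lie_fox_bracket\<close> contain a linear part, and linear parts of
  commutators are zero: the algebra of pairs is metabelian.\<close>

lemma lie_derived2_lin_fox: "w \<in> lie_derived2 \<Longrightarrow> lie_lin w = 0 \<and> lie_fox i w = 0"
  unfolding lie_derived2_def commutator_space_def
  by (induction rule: lie.span_induct_alt)
     (auto simp: lie_lin.zero lie_lin.add lie_lin.scale lie_fox.zero lie_fox.add lie_fox.scale
       lie_fox_bracket lie_lin_derived)

lift_definition metab_lin :: "('x, 'k::field) free_metab \<Rightarrow> ('x, 'k) pol" is lie_lin
  using lie_derived2_lin_fox unfolding metab_rel_def by (metis lie_lin.diff eq_iff_diff_eq_0)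

text \<open>
  The coordinates of the Magnus embedding: together with \<open>metab_lin\<close> they form a homomorphism to
  pairs \<open>(f, a)\<close> of polynomials with the bracket \<open>[(f, a), (g, b)] = (f b - g a, 0)\<close>.
\<close>

lift_definition metab_fox :: "'x \<Rightarrow> ('x, 'k::field) free_metab \<Rightarrow> ('x, 'k) pol" is lie_fox
  using lie_derived2_lin_fox unfolding metab_rel_def by (metis lie_fox.diff eq_iff_diff_eq_0)

interpretation metab_lin: Vector_Spaces.linear metab_scale pm_scale metab_lin
  unfolding Vector_Spaces.linear_iff
  by (intro conjI allI metab.vector_space_axioms pm.vector_space_axioms; transfer)
     (simp_all add: lie_lin.add lie_lin.scale)

interpretation metab_fox: Vector_Spaces.linear metab_scale pm_scale "metab_fox i" for i
  unfolding Vector_Spaces.linear_iff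
  by (intro conjI allI metab.vector_space_axioms pm.vector_space_axioms; transfer)
     (simp_all add: lie_fox.add lie_fox.scale)

lemma metab_lin_bracket [simp]: "metab_lin (metab_bracket p q) = 0"
  by transfer simp

lemma metab_fox_bracket:
  "metab_fox i (metab_bracket p q) = metab_fox i p * metab_lin q - metab_fox i q * metab_lin p"
  by transfer (rule lie_fox_bracket)

lemma metab_lin_gen [simp]: "metab_lin (metab_gen x) = pol_var x"
  by (simp add: metab_gen_def lie_gen_def metab_lin.abs_eq lie_lin.abs_eq)

lemma metab_fox_gen [simp]: "metab_fox i (metab_gen x) = (if x = i then 1 else 0)"
  by (simp add: metab_gen_def lie_gen_def metab_fox.abs_eq lie_fox.abs_eq)

lemma metab_lin_derived: "w \<in> metab_derived \<Longrightarrow> metab_lin w = 0"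
  unfolding commutator_space_def
  by (induction rule: metab.span_induct_alt) (auto simp: metab_lin.zero metab_lin.add metab_lin.scale)

text \<open>Elements of the commutator ideal have no linear part, so in the bracket formula only
  multiplication by the variable survives. The Magnus coordinates are therefore module homomorphisms
  there.\<close>

lemma metab_fox_pol_act:
  fixes w :: "('x::{finite,linorder}, 'k::field) free_metab"
  assumes w: "w \<in> metab_derived"
  shows "metab_fox i (pol_act w f) = metab_fox i w * f"
proof (rule pol_linear_eqI[where f = f and s = pm_scale])
  fix m
  show "metab_fox i (pol_act w (pol_monom m)) = metab_fox i w * pol_monom m"
  proof (induction m rule: monom_induct)
    case (add_var m x)
    then show ?case
      by (subst pol_act_monom_add_var[OF w], subst pol_monom_add_var)
        (simp add: metab_fox_bracket metab_lin_derived pol_act_in_derived w mult.assoc)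
  qed simp
qed (intro pm.vector_space_axioms linear_mult_right
    linear_compose_fun[OF linear_pol_act metab_fox.linear_axioms])+

text \<open>Normalisation for the contracting homotopy. A coordinate of degree \<open>n\<close>
  belongs to an element of the commutator ideal of degree \<open>n + 1\<close>, which explains the
  shifted divisor.\<close>

definition inv_euler :: "('x::finite, 'k::field) pol \<Rightarrow> ('x, 'k) pol"
  where "inv_euler = lin_ext pm_scale (\<lambda>m. pm_scale (1 / of_nat (Suc (monom_deg m))) (pol_monom m))"

interpretation inv_euler: Vector_Spaces.linear pm_scale pm_scale inv_euler
  unfolding inv_euler_def by (rule pm.linear_lin_ext)

lemma inv_euler_monom:
  "inv_euler (pol_monom m) = pm_scale (1 / of_nat (Suc (monom_deg m))) (pol_monom m)"
  unfolding inv_euler_def by (subst (1) pol_monom_def) simp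

text \<open>
  The Magnus embedding identifies the commutator ideal with the kernel of the Koszul differential
  \<open>(f\<^sub>i) \<mapsto> \<Sum>\<^sub>i f\<^sub>i x\<^sub>i\<close>. In characteristic 0 the usual contracting homotopy of the Koszul complex is thus a
  left inverse.
\<close>

lemma metab_fox_retraction:
  fixes w :: "('x::{finite,linorder}, 'k::field_char_0) free_metab"
  assumes "w \<in> metab_derived"
  shows "(\<Sum>i\<in>UNIV. pi_map i (inv_euler (metab_fox i w))) = w"
  using assms unfolding metab_derived_eq_span
proof (induction rule: metab.span_induct_alt)
  case base
  then show ?case by (simp add: metab_fox.zero inv_euler.zero pi_map.zero)
next
  case (step c p q)
  then obtain a b m where
    p: "p = pol_act (metab_bracket (metab_gen a) (metab_gen b)) (pol_monom m)"
    by (auto simp: poly_commutators_def)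
  let ?w = "metab_bracket (metab_gen a) (metab_gen b) :: ('x, 'k) free_metab"
  \<comment> \<open>The Magnus coordinates of \<open>p\<close> are monomials of degree one more than
    \<open>m\<close>; \<open>inv_euler\<close> adds another one.\<close>
  let ?n = "1 / of_nat (Suc (Suc (monom_deg m))) :: 'k"
  have fox: "metab_fox i p = (if i = a then pol_monom (m + Poly_Mapping.single b 1) else 0)
      - (if i = b then pol_monom (m + Poly_Mapping.single a 1) else 0)" for i
    unfolding p metab_fox_pol_act[OF metab_derived_bracket] pol_monom_add_var
    by (simp add: metab_fox_bracket left_diff_distrib mult.commute)
  have "(\<Sum>i\<in>UNIV. pi_map i (inv_euler (metab_fox i p)))
      = (\<Sum>i\<in>UNIV. (if i = a then pi_map i (inv_euler (pol_monom (m + Poly_Mapping.single b 1))) else 0)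
          - (if i = b then pi_map i (inv_euler (pol_monom (m + Poly_Mapping.single a 1))) else 0))"
    by (intro sum.cong) (auto simp: fox inv_euler.diff pi_map.diff inv_euler.zero pi_map.zero)
  also have "\<dots> = metab_scale ?n (pi_map a (pol_monom (m + Poly_Mapping.single b 1))
      - pi_map b (pol_monom (m + Poly_Mapping.single a 1)))"
    unfolding sum_subtractf inv_euler_monom monom_deg_add_var pi_map.scale
    by (simp add: metab.scale_right_diff_distrib)
  also have "pi_map a (pol_monom (m + Poly_Mapping.single b 1))
        - pi_map b (pol_monom (m + Poly_Mapping.single a 1))
      = (metab_bracket (pi_map a (pol_monom m)) (metab_gen b)
          - metab_bracket (pi_map b (pol_monom m)) (metab_gen a))
        + (p - pol_act (metab_bracket (metab_gen b) (metab_gen a)) (pol_monom m))"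
    unfolding pi_map_monom_add_var p by simp
  also have "pol_act (metab_bracket (metab_gen b) (metab_gen a)) (pol_monom m) = - p"
    unfolding p metab_bracket_anticomm[of "metab_gen b"] by (rule pol_act_left.neg)
  \<comment> \<open>The exchange identity contributes \<open>p\<close> as many times as the degree
    of \<open>m\<close>, and \<open>p - (- p)\<close> contributes it twice more; this cancels
    against \<open>?n\<close>.\<close>
  also have "metab_bracket (pi_map a (pol_monom m)) (metab_gen b)
        - metab_bracket (pi_map b (pol_monom m)) (metab_gen a)
        + (p - - p) = metab_scale (of_nat (Suc (Suc (monom_deg m)))) p"
  proof -
    have "of_nat (Suc (Suc (monom_deg m))) = of_nat (monom_deg m) + 1 + (1 :: 'k)" by simp
    then show ?thesis
      unfolding pi_map_swap p[symmetric]
      by (simp only: metab.scale_left_distrib metab.scale_one diff_minus_eq_add add.assoc)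
  qed
  also have "metab_scale ?n \<dots> = p" by (simp del: of_nat_Suc)
  finally show ?case using step(2)
    by (simp add: metab_fox.add metab_fox.scale inv_euler.add inv_euler.scale pi_map.add pi_map.scale
        sum.distrib flip: metab.scale_sum_right)
qed

lemma metab_fox_eq_0_imp:
  fixes w :: "('x::{finite,linorder}, 'k::field_char_0) free_metab"
  assumes "w \<in> metab_derived" "\<And>i. metab_fox i w = 0"
  shows "w = 0"
  using metab_fox_retraction[OF assms(1)] by (simp add: assms(2) inv_euler.zero pi_map.zero)


section \<open>The decomposition of the commutator ideal\<close>

lemma pol_eq_sum_monoms: "f = (\<Sum>m\<in>Poly_Mapping.keys f. pm_scale (Poly_Mapping.lookup f m) (pol_monom m))"
  by (rule poly_mapping_eqI)
    (auto simp: lookup_sum pol_monom_def lookup_single when_def in_keys_iff if_distrib[of "(*) _"]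
      cong: if_cong)

lemma subspace_pol_ring: "pm.subspace (pol_ring Y :: ('x, 'k::field) pol set)"
proof -
  have "f + g \<in> pol_ring Y" if "f \<in> pol_ring Y" "g \<in> pol_ring Y" for f g :: "('x, 'k) pol"
    using that keys_add[of f g] unfolding pol_ring_def by blast
  moreover have "pm_scale c f \<in> pol_ring Y" if "f \<in> pol_ring Y" for c and f :: "('x, 'k) pol"
  proof -
    have "Poly_Mapping.keys (pm_scale c f) \<subseteq> Poly_Mapping.keys f"
      by (rule subsetI) (simp add: in_keys_iff)
    then show ?thesis using that unfolding pol_ring_def by blast
  qed
  moreover have "0 \<in> (pol_ring Y :: ('x, 'k) pol set)" by (simp add: pol_ring_def)
  ultimately show ?thesis unfolding pm.subspace_def by blast
qed

lemma lookup_in_pol_ring: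
  assumes "f \<in> pol_ring (UNIV - {z})" "m \<in> Poly_Mapping.keys f"
  shows "Poly_Mapping.lookup m z = 0"
proof -
  have "z \<notin> Poly_Mapping.keys m" using assms unfolding pol_ring_def by blast
  then show ?thesis by (simp add: in_keys_iff)
qed

lemma subspace_aug_ideal: "pm.subspace (aug_ideal Y)"
  using subspace_pol_ring[of Y] unfolding pm.subspace_def aug_ideal_def by (auto simp: lookup_add)

lemma pol_monom_in_pol_ring: "Poly_Mapping.keys m \<subseteq> Y \<Longrightarrow> pol_monom m \<in> pol_ring Y"
  by (simp add: pol_monom_def pol_ring_def)

lemma pol_var_in_aug_ideal: "x \<in> Y \<Longrightarrow> pol_var x \<in> aug_ideal Y"
  by (auto simp: pol_var_def pol_monom_def pol_ring_def aug_ideal_def lookup_single when_def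
      single_zero[symmetric] simp del: single_zero dest!: arg_cong[of _ _ "\<lambda>m. Poly_Mapping.lookup m x"])

lemma pol_ring_mult:
  assumes "f \<in> pol_ring Y" "g \<in> pol_ring Y"
  shows "f * g \<in> pol_ring Y"
  unfolding pol_ring_def
proof (intro CollectI ballI)
  fix m assume "m \<in> Poly_Mapping.keys (f * g)"
  then obtain a b where "a \<in> Poly_Mapping.keys f" "b \<in> Poly_Mapping.keys g" "m = a + b"
    using keys_mult[of f g] by auto
  then show "Poly_Mapping.keys m \<subseteq> Y"
    using assms unfolding pol_ring_def by (simp add: keys_add_nat)
qed

lemma aug_ideal_mult:
  assumes "f \<in> aug_ideal Y" "g \<in> pol_ring Y"
  shows "f * g \<in> aug_ideal Y"
proof -
  have "0 \<notin> Poly_Mapping.keys (f * g)"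
  proof
    assume "0 \<in> Poly_Mapping.keys (f * g)"
    then obtain a b where ab: "a \<in> Poly_Mapping.keys f" "0 = a + b"
      using keys_mult[of f g] by auto
    have "Poly_Mapping.keys a = {}" using keys_add_nat[of a b] ab(2) by simp
    then show False using ab(1) assms(1) by (simp add: aug_ideal_def in_keys_iff)
  qed
  then show ?thesis using assms pol_ring_mult by (auto simp: aug_ideal_def in_keys_iff)
qed

section \<open>Independence of the powers of \<open>z\<close> over the polynomials in the other
  variables\<close>

lemma pol_var_power: "pol_var z ^ n = pol_monom (Poly_Mapping.single z n)"
proof (induction n)
  case (Suc n)
  then show ?case
    by (simp add: pol_var_def mult.commute flip: pol_monom_add single_add)
qed simp

text \<open>A monomial factors uniquely into a part without \<open>z\<close> and a power of
  \<open>z\<close>, so a product with another power of \<open>z\<close> cannot contribute to this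
  coefficient.\<close>

lemma lookup_mult_var_power:
  assumes f: "f \<in> pol_ring (UNIV - {z})" and s: "Poly_Mapping.lookup s z = 0"
  shows "Poly_Mapping.lookup (f * pol_var z ^ k) (s + Poly_Mapping.single z n)
    = (if k = n then Poly_Mapping.lookup f s else 0)"
proof -
  have eq: "a + Poly_Mapping.single z k = s + Poly_Mapping.single z n \<longleftrightarrow> k = n \<and> a = s"
    if "a \<in> Poly_Mapping.keys f" for a
  proof -
    have "Poly_Mapping.lookup a z = 0"
      using f that by (rule lookup_in_pol_ring)
    then have "k = n" if "a + Poly_Mapping.single z k = s + Poly_Mapping.single z n"
      using s arg_cong[OF that, of "\<lambda>m. Poly_Mapping.lookup m z"] by (simp add: lookup_add)
    then show ?thesis by auto
  qed
  have "Poly_Mapping.lookup (f * pol_var z ^ k) (s + Poly_Mapping.single z n)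
      = (\<Sum>a\<in>Poly_Mapping.keys f. Poly_Mapping.lookup f a *
          (if a + Poly_Mapping.single z k = s + Poly_Mapping.single z n then 1 else 0))"
    by (subst pol_eq_sum_monoms[of f])
      (simp add: pol_var_power sum_distrib_right pm_scale_mult lookup_sum pol_monom_def mult_single
        lookup_single when_def)
  also have "\<dots> = (\<Sum>a\<in>Poly_Mapping.keys f. if a = s then (if k = n then Poly_Mapping.lookup f s else 0) else 0)"
    by (intro sum.cong refl) (simp add: eq)
  also have "\<dots> = (if k = n then Poly_Mapping.lookup f s else 0)"
    by (simp add: in_keys_iff)
  finally show ?thesis .
qed

lemma sum_mult_var_power_eq_0:
  fixes p :: "nat \<Rightarrow> ('x, 'k::field) pol"
  assumes p: "\<And>n. p n \<in> pol_ring (UNIV - {z})" and sum: "(\<Sum>n<N. p n * pol_var z ^ n) = 0"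
    and n: "n < N"
  shows "p n = 0"
proof (rule poly_mapping_eqI)
  fix s
  show "Poly_Mapping.lookup (p n) s = Poly_Mapping.lookup 0 s"
  proof (cases "Poly_Mapping.lookup s z = 0")
    case True
    have "0 = Poly_Mapping.lookup (\<Sum>k<N. p k * pol_var z ^ k) (s + Poly_Mapping.single z n)"
      by (simp add: sum)
    also have "\<dots> = (\<Sum>k<N. if k = n then Poly_Mapping.lookup (p k) s else 0)"
      by (simp add: lookup_sum lookup_mult_var_power[OF p True])
    also have "\<dots> = Poly_Mapping.lookup (p n) s" using n by simp
    finally show ?thesis by simp
  next
    case False
    then have "s \<notin> Poly_Mapping.keys (p n)"
      using lookup_in_pol_ring[OF p[of n], of s] by auto
    then show ?thesis by (simp add: in_keys_iff)
  qed
qed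

section \<open>The Euler operator as the \<open>z\<close>-coordinate of \<pi>\<close>

definition euler :: "('x::finite, 'k::field) pol \<Rightarrow> ('x, 'k) pol"
  where "euler = lin_ext pm_scale (\<lambda>m. pm_scale (of_nat (monom_deg m)) (pol_monom m))"

lemma lookup_euler: "Poly_Mapping.lookup (euler f) m = of_nat (monom_deg m) * Poly_Mapping.lookup f m"
proof -
  have "Poly_Mapping.lookup (euler f) m
      = (\<Sum>a\<in>Poly_Mapping.keys f. if a = m then of_nat (monom_deg m) * Poly_Mapping.lookup f m else 0)"
    unfolding euler_def lin_ext_def lookup_sum
    by (intro sum.cong refl) (simp add: pol_monom_def lookup_single when_def)
  then show ?thesis by (simp add: in_keys_iff)
qed

lemma euler_in_pol_ring: "f \<in> pol_ring Y \<Longrightarrow> euler f \<in> pol_ring Y"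
  unfolding pol_ring_def by (auto simp: in_keys_iff lookup_euler)

text \<open>Each coefficient is multiplied by the degree of its monomial, which is invertible in
  characteristic 0 unless the monomial is constant; the augmentation ideal excludes that
  case.\<close>

lemma euler_eq_0_imp:
  fixes f :: "('x::finite, 'k::field_char_0) pol"
  assumes "f \<in> aug_ideal Y" "euler f = 0"
  shows "f = 0"
proof (rule poly_mapping_eqI)
  fix m
  show "Poly_Mapping.lookup f m = Poly_Mapping.lookup 0 m"
    using assms lookup_euler[of f m] by (cases "m = 0") (simp_all add: aug_ideal_def monom_deg_eq_0_iff)
qed

text \<open>The \<open>z\<close>-coordinate of \<open>[z,x]\<close> is \<open>x\<close> for
  \<open>x\<close> other than \<open>z\<close>. By the Leibniz rule the composite is thus the
  derivation fixing these variables, that is, the Euler operator.\<close>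

lemma metab_fox_pi_map:
  fixes f :: "('x::{finite,linorder}, 'k::field) pol"
  assumes "f \<in> pol_ring (UNIV - {z})"
  shows "metab_fox z (pi_map z f) = euler f"
proof (rule pol_linear_eqI[where f = f and s = pm_scale])
  fix m assume "m \<in> Poly_Mapping.keys f"
  then have "Poly_Mapping.keys m \<subseteq> UNIV - {z}" using assms by (auto simp: pol_ring_def)
  then have "metab_fox z (pi_map z (pol_monom m :: ('x, 'k) pol))
      = pm_scale (of_nat (monom_deg m)) (pol_monom m)"
  proof (induction m rule: monom_induct)
    case zero
    then show ?case by (simp add: metab_fox.zero)
  next
    case (add_var m x)
    then have x: "x \<noteq> z" "metab_fox z (pi_map z (pol_monom m :: ('x, 'k) pol))
      = pm_scale (of_nat (monom_deg m)) (pol_monom m)"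
      by (auto simp: keys_add_nat)
    have "metab_fox z (pi_map z (pol_monom (m + Poly_Mapping.single x 1) :: ('x, 'k) pol))
        = metab_fox z (pi_map z (pol_monom m)) * pol_var x + pol_var x * pol_monom m"
      unfolding pi_map_monom_add_var metab_fox.add metab_fox_pol_act[OF metab_derived_bracket]
      using x(1) by (simp add: metab_fox_bracket metab_lin_derived pi_map_in_derived)
    then show ?case
      by (simp only: x(2) monom_deg_add_var pol_monom_add_var)
        (simp add: pm_scale_mult pm.scale_left_distrib mult.commute add.commute)
  qed
  moreover have "euler (pol_monom m) = (pm_scale (of_nat (monom_deg m)) (pol_monom m) :: ('x, 'k) pol)"
    unfolding euler_def by (subst pol_monom_def) simp
  ultimately show "metab_fox z (pi_map z (pol_monom m :: ('x, 'k) pol)) = euler (pol_monom m)" by simp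
qed (auto simp: euler_def intro!: pm.vector_space_axioms pm.linear_lin_ext
    linear_compose_fun[OF linear_pi_map metab_fox.linear_axioms])

text \<open>For a spanning element \<open>[a,b] m\<close> the nonzero coordinates sit only at
  \<open>a\<close> and \<open>b\<close>, with values \<open>m b\<close> and \<open>- m a\<close>,
  all built from \<open>Y\<close>.\<close>

lemma metab_fox_commutator:
  fixes Y :: "'x::{finite,linorder} set"
  assumes "w \<in> (metab_commutator (metab_subalg Y) :: ('x, 'k::field) free_metab set)"
  shows "metab_fox i w \<in> pol_ring Y" "i \<notin> Y \<Longrightarrow> metab_fox i w = 0"
proof -
  have "metab_fox i w \<in> pol_ring Y \<and> (i \<notin> Y \<longrightarrow> metab_fox i w = 0)"
    using assms unfolding commutator_metab_subalg
  proof (induction rule: metab.span_induct_alt)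
    case base
    then show ?case by (simp add: metab_fox.zero pm.subspace_0[OF subspace_pol_ring])
  next
    case (step c p q)
    then obtain a b m where
      p: "p = pol_act (metab_bracket (metab_gen a) (metab_gen b)) (pol_monom m)"
      and Y: "a \<in> Y" "b \<in> Y" "Poly_Mapping.keys m \<subseteq> Y"
      by (auto simp: poly_commutators_def)
    have "metab_fox i p = (if a = i then pol_monom (m + Poly_Mapping.single b 1) else 0)
        - (if b = i then pol_monom (m + Poly_Mapping.single a 1) else 0)"
      unfolding p metab_fox_pol_act[OF metab_derived_bracket] pol_monom_add_var
      by (simp add: metab_fox_bracket left_diff_distrib mult.commute)
    moreover have "\<dots> \<in> pol_ring Y"
      using Y by (intro pm.subspace_diff subspace_pol_ring)
        (auto simp: keys_add_nat pm.subspace_0[OF subspace_pol_ring] intro!: pol_monom_in_pol_ring)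
    ultimately have "metab_fox i p \<in> pol_ring Y" "i \<notin> Y \<Longrightarrow> metab_fox i p = 0"
      using Y by auto
    then show ?case
      using step(2) by (auto simp: metab_fox.add metab_fox.scale
          intro!: pm.subspace_add pm.subspace_scale subspace_pol_ring)
  qed
  then show "metab_fox i w \<in> pol_ring Y" "i \<notin> Y \<Longrightarrow> metab_fox i w = 0" by auto
qed

lemma commutator_subalg_derived: "w \<in> metab_commutator (metab_subalg Y) \<Longrightarrow> w \<in> metab_derived"
  using commutator_mono[of "metab_subalg Y" UNIV] by auto

lemma commutator_decomposition_direct:
  fixes a :: "nat \<Rightarrow> ('x::{finite,linorder}, 'k::field_char_0) free_metab"
  assumes a: "\<And>n. a n \<in> metab_commutator (metab_subalg (UNIV - {z}))"
    and b: "\<And>n. b n \<in> aug_ideal (UNIV - {z})"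
    and sum: "(\<Sum>n<N. pol_act (a n) (pol_var z ^ n) + pol_act (pi_map z (b n)) (pol_var z ^ n)) = 0"
  shows "\<forall>n<N. a n = 0 \<and> b n = 0"
proof -
  have a': "a n \<in> metab_derived" for n using a by (rule commutator_subalg_derived)
  have b': "b n \<in> pol_ring (UNIV - {z})" for n using b by (simp add: aug_ideal_def)
  have fox: "(\<Sum>n<N. (metab_fox i (a n) + metab_fox i (pi_map z (b n))) * pol_var z ^ n) = 0" for i
    using arg_cong[OF sum, of "metab_fox i"]
    by (simp add: metab_fox.sum metab_fox.add metab_fox.zero metab_fox_pol_act a' pi_map_in_derived
        distrib_right)
  \<comment> \<open>The \<open>z\<close>-coordinate annihilates every \<open>a n\<close> and turns
    \<open>pi_map z (b n)\<close> into \<open>euler (b n)\<close>, isolating the second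
    family.\<close>
  have "(\<Sum>n<N. euler (b n) * pol_var z ^ n) = 0"
    using fox[of z] by (simp add: metab_fox_commutator(2)[OF a] metab_fox_pi_map b')
  then have "euler (b n) = 0" if "n < N" for n
    using that by (rule sum_mult_var_power_eq_0[OF euler_in_pol_ring[OF b']])
  then have b0: "b n = 0" if "n < N" for n using that euler_eq_0_imp[OF b] by blast
  \<comment> \<open>With the second family gone, all coordinates of the \<open>a n\<close> can be
    compared, and together they determine an element of the commutator ideal.\<close>
  have "(\<Sum>n<N. metab_fox i (a n) * pol_var z ^ n) = 0" for i
    using fox[of i] by (simp add: b0 pi_map.zero metab_fox.zero)
  then have "metab_fox i (a n) = 0" if "n < N" for i n
    using that by (rule sum_mult_var_power_eq_0[OF metab_fox_commutator(1)[OF a]])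
  then show ?thesis using b0 metab_fox_eq_0_imp[OF a'] by blast
qed

lemma pi_map_in_commutator:
  fixes b :: "'x::{finite,linorder}"
  assumes "b \<in> Y" "Poly_Mapping.keys m \<subseteq> Y"
  shows "pi_map b (pol_monom m) \<in> (metab_commutator (metab_subalg Y) :: ('x, 'k::field) free_metab set)"
proof -
  have "Poly_Mapping.keys (m - Poly_Mapping.single x 1) \<subseteq> Y" for x
    using assms(2) by (auto simp: in_keys_iff lookup_minus)
  then show ?thesis
    unfolding pi_map_monom pi_monom_def using assms
    by (intro metab.subspace_sum metab.subspace_scale subspace_commutator poly_commutator_in_commutator) auto
qed

text \<open>The span on the right is closed under the action of powers of \<open>z\<close>. It thus
  suffices to reach \<open>[a,b] m\<close> with \<open>m\<close> free of \<open>z\<close>; if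
  neither \<open>a\<close> nor \<open>b\<close> is \<open>z\<close> this lies in the first family
  already.\<close>

lemma commutator_decomposition_span:
  fixes z :: "'x::{finite,linorder}"
  defines "Y \<equiv> UNIV - {z}"
  shows "(metab_derived :: ('x, 'k::field_char_0) free_metab set) = metab.span
    ((\<Union>n. (\<lambda>w. pol_act w (pol_var z ^ n)) ` metab_commutator (metab_subalg Y)) \<union>
     (\<Union>n. (\<lambda>f. pol_act (pi_map z f) (pol_var z ^ n)) ` aug_ideal Y))"
    (is "_ = metab.span ?G")
proof
  show "metab.span ?G \<subseteq> metab_derived"
    by (intro metab.span_minimal subspace_commutator)
       (auto intro!: pol_act_in_derived pi_map_in_derived intro: commutator_subalg_derived)
  have A: "pol_act w (pol_var z ^ n) \<in> metab.span ?G" if "w \<in> metab_commutator (metab_subalg Y)" for w n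
    using that by (intro metab.span_base) blast
  have B: "pol_act (pi_map z f) (pol_var z ^ n) \<in> metab.span ?G" if "f \<in> aug_ideal Y" for f n
    using that by (intro metab.span_base) blast
  have shift: "pol_act w (pol_var z ^ k) \<in> metab.span ?G" if "w \<in> metab.span ?G" for w k
    using that
  proof (induction rule: metab.span_induct_alt)
    case base
    then show ?case by (simp add: pol_act_left.zero metab.span_zero)
  next
    case (step c p q)
    have "pol_act p (pol_var z ^ k) \<in> metab.span ?G"
      using step(1)
    proof (elim UnE UN_E imageE)
      fix n w assume w: "w \<in> metab_commutator (metab_subalg Y)" "p = pol_act w (pol_var z ^ n)"
      then have "pol_act p (pol_var z ^ k) = pol_act w (pol_var z ^ (n + k))"
        by (simp add: power_add pol_act_mult commutator_subalg_derived)
      then show ?thesis using A[OF w(1)] by simp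
    next
      fix n f assume f: "f \<in> aug_ideal Y" "p = pol_act (pi_map z f) (pol_var z ^ n)"
      then have "pol_act p (pol_var z ^ k) = pol_act (pi_map z f) (pol_var z ^ (n + k))"
        by (simp add: power_add pol_act_mult pi_map_in_derived)
      then show ?thesis using B[OF f(1)] by simp
    qed
    then show ?case
      using step(2) by (simp add: pol_act_left.add pol_act_left.scale metab.span_add metab.span_scale)
  qed
  let ?g = "metab_gen :: 'x \<Rightarrow> ('x, 'k) free_metab"
  have z_left: "pol_act (metab_bracket (?g z) (?g b)) (pol_monom m) \<in> metab.span ?G"
    if b: "b \<in> Y" and m: "Poly_Mapping.keys m \<subseteq> Y" for b m
  proof -
    let ?w = "pol_act (metab_bracket (?g z) (?g b)) (pol_monom m)"
    let ?n = "of_nat (Suc (monom_deg m)) :: 'k"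
    \<comment> \<open>The Leibniz rule gives \<open>\<pi>(m b) = \<pi>(m) b + [z,b] m\<close>, and
      the exchange identity replaces \<open>\<pi>(m) b - \<pi>\<^sub>b(m) z\<close> by
      \<open>[z,b] m\<close> times the degree of \<open>m\<close>. The total coefficient
      \<open>?n\<close> is invertible in characteristic 0.\<close>
    have eq: "metab_scale ?n ?w
        = pi_map z (pol_monom (m + Poly_Mapping.single b 1)) - metab_bracket (pi_map b (pol_monom m)) (?g z)"
      unfolding pi_map_monom_add_var using pi_map_swap[of z m b, where ?'k = 'k]
      by (simp add: metab.scale_left_distrib algebra_simps)
    have "pol_monom (m + Poly_Mapping.single b 1) \<in> (aug_ideal Y :: ('x, 'k) pol set)"
      unfolding pol_monom_add_var mult.commute[of _ "pol_var b"]
      using b m by (intro aug_ideal_mult pol_var_in_aug_ideal pol_monom_in_pol_ring)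
    then have "pi_map z (pol_monom (m + Poly_Mapping.single b 1)) \<in> metab.span ?G"
      using B[of _ 0] by simp
    moreover have "metab_bracket (pi_map b (pol_monom m)) (?g z) \<in> metab.span ?G"
      using A[OF pi_map_in_commutator[OF b m], of 1] by (simp add: pol_act_var pi_map_in_derived)
    ultimately have "metab_scale (1 / ?n) (metab_scale ?n ?w) \<in> metab.span ?G"
      unfolding eq by (intro metab.span_scale metab.span_diff)
    then show ?thesis by (simp del: of_nat_Suc)
  qed
  have no_z: "pol_act (metab_bracket (?g a) (?g b)) (pol_monom m) \<in> metab.span ?G"
    if m: "Poly_Mapping.keys m \<subseteq> Y" for a b m
  proof -
    consider "a = b" | "a \<in> Y" "b \<in> Y" | "a = z" "b \<in> Y" | "a \<in> Y" "b = z"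
      by (auto simp: Y_def)
    then show ?thesis
    proof cases
      case 1
      then show ?thesis by (simp add: pol_act_left.zero metab.span_zero)
    next
      case 2
      then show ?thesis using A[OF poly_commutator_in_commutator[OF 2 m], of 0] by simp
    next
      case 3
      then show ?thesis using z_left m by simp
    next
      case 4
      then show ?thesis using z_left[OF 4(1) m]
        by (subst metab_bracket_anticomm) (simp add: pol_act_left.neg metab.span_neg)
    qed
  qed
  have "poly_commutators UNIV \<subseteq> metab.span ?G"
  proof
    fix p :: "('x, 'k) free_metab" assume "p \<in> poly_commutators UNIV"
    then obtain a b m where p: "p = pol_act (metab_bracket (?g a) (?g b)) (pol_monom m)"
      by (auto simp: poly_commutators_def)
    \<comment> \<open>Splitting off the full power of \<open>z\<close> leaves a monomial
      \<open>m'\<close> covered by \<open>no_z\<close>; \<open>shift\<close> puts the power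
      back.\<close>
    define n where "n = Poly_Mapping.lookup m z"
    define m' where "m' = m - Poly_Mapping.single z n"
    have m: "m = m' + Poly_Mapping.single z n"
      by (rule poly_mapping_eqI)
        (auto simp: m'_def n_def lookup_add lookup_minus lookup_single when_def)
    have "Poly_Mapping.keys m' \<subseteq> Y"
      by (auto simp: Y_def m'_def n_def in_keys_iff lookup_minus)
    then show "p \<in> metab.span ?G"
      unfolding p m pol_monom_add pol_act_mult[OF metab_derived_bracket] pol_var_power[symmetric]
      by (intro shift no_z)
  qed
  then show "metab_derived \<subseteq> metab.span ?G"
    unfolding metab_derived_eq_span by (intro metab.span_minimal) auto
qed

section \<open>Stability of the summands under the derivations\<close>

context linear_derivations
begin

lemma DL_metab_subalg:
  assumes d: "\<And>y. y \<in> Y \<Longrightarrow> Poly_Mapping.keys (d y) \<subseteq> Y" and w: "w \<in> metab_subalg Y"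
  shows "DL w \<in> metab_subalg Y"
proof -
  have gen: "DL (metab_gen y) \<in> metab_subalg Y" if "y \<in> Y" for y
    unfolding DL_gen metab_linear_def using d[OF that]
    by (intro metab.subspace_sum metab.subspace_scale subspace_metab_subalg gen_in_metab_subalg) auto
  \<comment> \<open>The set on the right is a subalgebra by the Leibniz rule, for which the elements
    themselves must also lie in \<open>metab_subalg Y\<close>.\<close>
  have "metab_subalg Y \<subseteq> {w \<in> metab_subalg Y. DL w \<in> metab_subalg Y}"
    using gen subspace_metab_subalg[of Y] 
    by (intro metab_subalg_minimal)
      (auto simp: metab.subspace_def DL.zero DL.add DL.scale DL_bracket bracket_in_metab_subalg
        gen_in_metab_subalg)
  then show ?thesis using w by auto
qed

text \<open>Constants are killed, and in every other monomial the Leibniz rule produces a factor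
  \<open>DP (pol_var x)\<close>, a linear form in \<open>Y\<close> without constant term.\<close>

lemma DP_aug_ideal:
  assumes d: "\<And>y. y \<in> Y \<Longrightarrow> Poly_Mapping.keys (d y) \<subseteq> Y" and f: "f \<in> pol_ring Y"
  shows "DP f \<in> aug_ideal Y"
proof -
  have "DP (pol_monom m) \<in> aug_ideal Y" if "Poly_Mapping.keys m \<subseteq> Y" for m
    using that
  proof (induction m rule: monom_induct)
    case zero
    then show ?case by (simp add: pm.subspace_0[OF subspace_aug_ideal])
  next
    case (add_var m x)
    then have x: "x \<in> Y" "Poly_Mapping.keys m \<subseteq> Y" by (auto simp: keys_add_nat)
    have "DP (pol_var x) \<in> aug_ideal Y"
      unfolding DP_var pol_linear_def using d[OF x(1)]
      by (intro pm.subspace_sum pm.subspace_scale subspace_aug_ideal pol_var_in_aug_ideal) auto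
    moreover have "pol_var x \<in> (pol_ring Y :: ('x, 'k) pol set)"
      by (rule pol_monom_in_pol_ring[of "Poly_Mapping.single x 1" Y, folded pol_var_def]) (simp add: x(1))
    ultimately show ?case
      using x add_var.IH unfolding pol_monom_add_var DP_mult mult.commute[of _ "DP (pol_var x)"]
      by (intro pm.subspace_add subspace_aug_ideal aug_ideal_mult pol_monom_in_pol_ring) auto
  qed
  then show ?thesis
    using f unfolding pol_ring_def
    by (subst pol_eq_sum_monoms)
      (auto simp: DP.sum DP.scale intro!: pm.subspace_sum pm.subspace_scale subspace_aug_ideal)
qed

lemma DP_var_power:
  assumes "d z = 0"
  shows "DP (pol_var z ^ n) = 0"
proof (induction n)
  case (Suc n)
  have "DP (pol_var z) = 0" by (simp add: DP_var assms pol_linear_def)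
  then show ?case using Suc by (simp add: DP_mult)
qed simp

end

text \<open>A variable is sent to zero or to a multiple of its predecessor in the same cell; the
  cell of \<open>z\<close> is a singleton, so \<open>z\<close> precedes nothing.\<close>

lemma jordan_basis_last_cell:
  assumes "jordan_basis \<delta> cells" "last cells = [z]"
  shows "\<delta> (kx z) = 0" "y \<noteq> z \<Longrightarrow> Poly_Mapping.keys (\<delta> (kx y)) \<subseteq> UNIV - {z}"
proof -
  have concat: "concat cells = sorted_list_of_set UNIV"
    and cell: "\<And>c. c \<in> set cells \<Longrightarrow> c \<noteq> [] \<and> \<delta> (kx (c ! 0)) = 0 \<and>
      (\<forall>k. Suc k < length c \<longrightarrow> (\<exists>a. a \<noteq> 0 \<and> \<delta> (kx (c ! Suc k)) = pm_scale a (kx (c ! k))))"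
    using assms(1) by (auto simp: jordan_basis_def)
  have "set (concat cells) = UNIV" "distinct (concat cells)" by (simp_all add: concat)
  then have "cells \<noteq> []" by auto
  then have z: "[z] \<in> set cells" using last_in_set[of cells] assms(2) by simp
  then show "\<delta> (kx z) = 0" using cell by force
  obtain c where c: "c \<in> set cells" "y \<in> set c" using \<open>set (concat cells) = UNIV\<close> by auto
  then obtain k where k: "k < length c" "c ! k = y" by (auto simp: in_set_conv_nth)
  show "Poly_Mapping.keys (\<delta> (kx y)) \<subseteq> UNIV - {z}"
  proof (cases k)
    case 0
    then show ?thesis using cell[OF c(1)] k by simp
  next
    case (Suc l)
    then obtain a where "\<delta> (kx y) = pm_scale a (kx (c ! l))" using cell[OF c(1)] k by blast
    then have "Poly_Mapping.keys (\<delta> (kx y)) \<subseteq> {c ! l}"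
      by (auto simp: in_keys_iff kx_def lookup_single when_def split: if_splits)
    moreover have "c ! l \<noteq> z"
    \<comment> \<open>Cells are disjoint, so a cell containing \<open>z\<close> equals
      \<open>[z]\<close>, which is too short to have a position \<open>Suc l\<close>.\<close>
    proof
      assume "c ! l = z"
      then have "set c \<inter> set [z] \<noteq> {}" using k Suc nth_mem[of l c] by auto
      then have "c = [z]" using \<open>distinct (concat cells)\<close> c(1) z unfolding distinct_concat_iff by blast
      then show False using k Suc by simp
    qed
    ultimately show ?thesis by auto
  qed
qed

theorem theorem4p3:
  fixes \<delta> :: "('x::{finite,linorder} \<Rightarrow>\<^sub>0 'k::field_char_0) \<Rightarrow> ('x \<Rightarrow>\<^sub>0 'k)"
    and DP :: "('x, 'k) pol \<Rightarrow> ('x, 'k) pol"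
    and DL :: "('x, 'k) free_metab \<Rightarrow> ('x, 'k) free_metab"
    and cells :: "'x list list"
    and xd :: 'x
    and I :: "'i set" and v :: "'i \<Rightarrow> ('x, 'k) free_metab"
    and J :: "'j set" and u :: "'j \<Rightarrow> ('x, 'k) pol"
  assumes "weitzenboeck \<delta> DP DL"
    and "jordan_basis \<delta> cells"
    and "last cells = [xd]"
    and "basis_family metab_scale I v (kernel_in DL (metab_commutator (metab_subalg (UNIV - {xd}))))"
    and "\<And>i. i \<in> I \<Longrightarrow> metab_homogeneous total_degree (v i)"
    and "\<And>i. i \<in> I \<Longrightarrow> metab_homogeneous (bidegree cells) (v i)"
    and "basis_family pm_scale J u (kernel_in DP (aug_ideal (UNIV - {xd})))"
    and "\<And>j. j \<in> J \<Longrightarrow> pol_homogeneous total_degree (u j)"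
    and "\<And>j. j \<in> J \<Longrightarrow> pol_homogeneous (bidegree cells) (u j)"
  shows "basis_family metab_scale ((I \<times> UNIV) <+> (J \<times> UNIV))
      (case_sum (\<lambda>(i, n :: nat). pol_act (v i) (pol_var xd ^ n))
                (\<lambda>(j, n :: nat). pol_act (pi_map xd (u j)) (pol_var xd ^ n)))
      (kernel_in DL (metab_commutator UNIV))"
proof -
  have var: "pol_linear (kx x) = (pol_var x :: ('x, 'k) pol)"
    "metab_linear (kx x) = (metab_gen x :: ('x, 'k) free_metab)" for x
    by (simp_all add: pol_linear_def metab_linear_def kx_def)
  interpret linear_derivations DP DL "\<lambda>x. \<delta> (kx x)"
    using assms(1) unfolding weitzenboeck_def
    by unfold_locales (auto simp flip: var)
  let ?Y = "UNIV - {xd}"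
  note z = jordan_basis_last_cell[OF assms(2,3)]
  \<comment> \<open>This makes both the subalgebra and the augmentation ideal in the remaining
    variables stable under the derivations.\<close>
  have Y: "Poly_Mapping.keys (\<delta> (kx y)) \<subseteq> ?Y" if "y \<in> ?Y" for y using z(2) that by blast
  show ?thesis
  \<comment> \<open>The \<open>n\<close>-th copies of the two summands are their images under
    multiplication by the \<open>n\<close>-th power of \<open>xd\<close>. This power is killed by
    \<open>DP\<close>, so the derivations act on the copies as on the summands themselves.\<close>
  proof (rule basis_family_kernel_direct_sum[where ?s1.0 = metab_scale and ?s2.0 = pm_scale
        and A = "metab_commutator (metab_subalg ?Y)" and B = "aug_ideal ?Y"
        and \<alpha> = "\<lambda>n w. pol_act w (pol_var xd ^ n)"
        and \<beta> = "\<lambda>n f. pol_act (pi_map xd f) (pol_var xd ^ n)"])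
    show "Vector_Spaces.linear metab_scale metab_scale (\<lambda>w. pol_act w (pol_var xd ^ n))" for n
      by (rule linear_pol_act_left)
    show "Vector_Spaces.linear pm_scale metab_scale (\<lambda>f. pol_act (pi_map xd f) (pol_var xd ^ n))" for n
      by (rule linear_compose_fun[OF linear_pi_map linear_pol_act_left])
    show "DL (pol_act w (pol_var xd ^ n)) = pol_act (DL w) (pol_var xd ^ n)"
      if "w \<in> metab_commutator (metab_subalg ?Y)" for n w
      using that by (simp add: DL_pol_act DP_var_power z(1) pol_act.zero commutator_subalg_derived)
    show "DL (pol_act (pi_map xd f) (pol_var xd ^ n)) = pol_act (pi_map xd (DP f)) (pol_var xd ^ n)"
      for n f
      by (simp add: DL_pol_act DL_pi_map pi_map_in_derived DP_var_power z(1) pol_act.zero)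
    show "DL w \<in> metab_commutator (metab_subalg ?Y)" if "w \<in> metab_commutator (metab_subalg ?Y)" for w
      using DL_commutator[OF DL_metab_subalg[OF Y] that] .
    show "DP f \<in> aug_ideal ?Y" if "f \<in> aug_ideal ?Y" for f
      using DP_aug_ideal[OF Y] that by (simp add: aug_ideal_def)
  qed (rule subspace_commutator subspace_aug_ideal commutator_decomposition_direct
      commutator_decomposition_span DL.linear_axioms assms(4,7) | assumption)+
qed

end
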